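(* Consider the closed fractured poroelastic system described in the context, with boundary conditions $\mathbf{w}=\mathbf{0}$ and $\mathbf{u}\cdot\mathbf{n}=0$ on $\partial\Omega$ ($\mathbf{n}$ the unit outward normal to $\partial\Omega$) and zero gravity $\mathbf{g}=\mathbf{0}$. Let $(\mathbf{w},p,p_c)$ be a (sufficiently regular) solution of the coupled model and let $\xi=\alpha p-\lambda\nabla\cdot\mathbf{w}$. Define the total free energy $$E_{\mathrm{tot}}(t)=\frac12\int_{\Omega\setminus\mathcal{C}}2G\,\epsilon(\mathbf{w}):\epsilon(\mathbf{w})\,d\mathbf{x}+\frac12\int_{\Omega\setminus\mathcal{C}}\frac1\lambda(\alpha p-\xi)^2\,d\mathbf{x}+\frac12\int_{\Omega\setminus\mathcal{C}}c_0p^2\,d\mathbf{x}+\frac12\int_{\mathcal{C}}c_fp_c^2\,d\mathbf{s}.$$ Then the following energy law holds: $$\frac{\partial E_{\mathrm{tot}}}{\partial t}+\Big(\frac{\mathbf{K}}{\eta}\nabla p,\nabla p\Big)_{\Omega\setminus\mathcal{C}}+\Big(\frac{\mathbf{K}_f}{\eta}\overline\nabla p_c,\overline\nabla p_c\Big)_{\mathcal{C}}=\Big(\mathbf{f},\frac{\partial\mathbf{w}}{\partial t}\Big)_{\Omega\setminus\mathcal{C}}+(\tilde g_s,p)_{\Omega\setminus\mathcal{C}}+(\tilde g_f,p_c)_{\mathcal{C}}.$$ In particular, if $\mathbf{f}=\mathbf{0}$, $\tilde g_s=0$ and $\tilde g_f=0$, then $$\frac{\partial E_{\mathrm{tot}}}{\partial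 t}=-\Big\|\Big(\frac{\mathbf{K}}{\eta}\Big)^{1/2}\nabla p\Big\|_{L^2(\Omega\setminus\mathcal{C})}^2-\Big\|\Big(\frac{\mathbf{K}_f}{\eta}\Big)^{1/2}\overline\nabla p_c\Big\|_{L^2(\mathcal{C})}^2\le 0 .$$
   Context: Geometry: $\Omega\subset\mathbb{R}^d$, $d\in\{2,3\}$, is a bounded domain with polygonal (polyhedral) boundary; the fracture $\mathcal{C}\subset\Omega$ is a $(d-1)$-dimensional polygonal interface. For a function $f$ on $\Omega\setminus\mathcal{C}$ with traces $f^{+},f^{-}$ on the two sides of $\mathcal{C}$, $[f]_{\mathcal{C}}=[f]=f^+-f^-$; $\mathbf{n}^+$ is the unit normal on $\mathcal{C}$ pointing out of the $+$ side (toward the $-$ side). $\overline\nabla$ is the tangential gradient along $\mathcal{C}$, and $\overline\nabla\cdot$ the tangential divergence. $(\cdot,\cdot)_{\Omega\setminus\mathcal{C}}$ and $(\cdot,\cdot)_{\mathcal{C}}$ denote $L^2$ inner products. Parameters: $\lambda,G>0$ Lamé constants, $\alpha>0$ Biot coefficient, $c_0\ge0$ storage coefficient, $c_f>0$ fluid compressibility, $\eta>0$ viscosity, $\mathbf{K}$ and $\mathbf{K}_f$ time-independent symmetric positive definite permeabilities (scalar multiples of the identity, $\mathbf{K}=k\mathbf{I}$, $\mathbf{K}_f=k_f\mathbf{I}$). $\epsilon(\mathbf{w})=\frac12(\nabla\mathbf{w}+\nabla\mathbf{w}^T)$. Model (with zero gravity). Unknowns: displacement $\mathbf{w}$ and matrix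 pressure $p$ on $\Omega\setminus\mathcal{C}$, fracture pressure $p_c$ on $\mathcal{C}$. With $\sigma^{\mathrm{por}}=\lambda(\nabla\cdot\mathbf{w})\mathbf{I}+2G\epsilon(\mathbf{w})-\alpha p\mathbf{I}$, in $\Omega\setminus\mathcal{C}$: $$-\nabla\cdot\sigma^{\mathrm{por}}=\mathbf{f},\qquad \frac{\partial}{\partial t}(c_0p+\alpha\nabla\cdot\mathbf{w})+\nabla\cdot\mathbf{u}=\tilde g_s,\qquad \mathbf{u}=-\frac{\mathbf{K}}{\eta}\nabla p;$$ on $\mathcal{C}$: $$\frac{\partial(w_f+c_fp_c)}{\partial t}+\overline\nabla\cdot\mathbf{u}_f=\tilde g_f+[\mathbf{u}]_{\mathcal{C}}\cdot\mathbf{n}^+,\quad \mathbf{u}_f=-\frac{\mathbf{K}_f}{\eta}\overline\nabla p_c,\quad w_f=-[\mathbf{w}]_{\mathcal{C}}\cdot\mathbf{n}^+ .$$ Interface conditions: $\sigma^{\mathrm{por}}\mathbf{n}=-p_c\mathbf{n}$ on each side of $\mathcal{C}$, and $p_c=p|_{\mathcal{C}}$ ($p$ continuous across $\mathcal{C}$). The fracture width $w_f$ is bounded on $\mathcal{C}$ and vanishes on $\partial\mathcal{C}$, and boundary terms on $\partial\mathcal{C}$ in the fracture equation vanish. With $\xi=\alpha p-\lambda\nabla\cdot\mathbf{w}$, the corresponding weak formulation is: for all test functions $\mathbf{v}\in H^1(\Omega\setminus\mathcal{C})^d$ with $\mathbf{v}|_{\partial\Omega}=\mathbf{0}$, $\theta\in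 L^2(\Omega\setminus\mathcal{C})$, $q\in H^1(\Omega)$ with $q|_{\mathcal{C}}\in H^1(\mathcal{C})$, $q_c\in H^1(\mathcal{C})$, $$2G(\epsilon(\mathbf{w}),\epsilon(\mathbf{v}))_{\Omega\setminus\mathcal{C}}-(\xi,\nabla\cdot\mathbf{v})_{\Omega\setminus\mathcal{C}}+(p_c,[\mathbf{v}]\cdot\mathbf{n}^+)_{\mathcal{C}}=(\mathbf{f},\mathbf{v})_{\Omega\setminus\mathcal{C}},$$ $$\tfrac1\lambda(\xi,\theta)_{\Omega\setminus\mathcal{C}}+(\nabla\cdot\mathbf{w},\theta)_{\Omega\setminus\mathcal{C}}-\tfrac{\alpha}{\lambda}(p,\theta)_{\Omega\setminus\mathcal{C}}=0,$$ $$\big(c_0+\tfrac{\alpha^2}{\lambda}\big)(\partial_tp,q)_{\Omega\setminus\mathcal{C}}-\tfrac\alpha\lambda(\partial_t\xi,q)_{\Omega\setminus\mathcal{C}}+(\tfrac{\mathbf{K}}{\eta}\nabla p,\nabla q)_{\Omega\setminus\mathcal{C}}-([\tfrac{\mathbf{K}}{\eta}\nabla p]\cdot\mathbf{n}^+,q)_{\mathcal{C}}=(\tilde g_s,q)_{\Omega\setminus\mathcal{C}},$$ $$(\partial_tw_f,q_c)_{\mathcal{C}}+c_f(\partial_tp_c,q_c)_{\mathcal{C}}+(\tfrac{\mathbf{K}_f}{\eta}\overline\nabla p_c,\overline\nabla q_c)_{\mathcal{C}}+([\tfrac{\mathbf{K}}{\eta}\nabla p]\cdot\mathbf{n}^+,q_c)_{\mathcal{C}}=(\tilde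 g_f,q_c)_{\mathcal{C}}.$$ "Sufficiently regular" means that these equations hold pointwise in time and that all terms in the claim are defined (in particular $\partial_t\mathbf{w},\partial_tp,\partial_t\xi,\partial_tp_c$ exist and $\partial_t\mathbf{w}$ is an admissible test function $\mathbf{v}$). *)

theory Defs
  imports "HOL-Analysis.Analysis"
begin

section \<open>Square integrable fields\<close>

definition L2 :: "'a measure \<Rightarrow> ('a \<Rightarrow> 'b::euclidean_space) \<Rightarrow> bool" where
  "L2 M f \<longleftrightarrow> f \<in> borel_measurable M \<and> integrable M (\<lambda>x. (norm (f x))\<^sup>2)"

text \<open>On matrices the library inner product is the Frobenius product \<open>A : B\<close>.\<close>

definition L2_inner :: "'a measure \<Rightarrow> ('a \<Rightarrow> 'b::euclidean_space) \<Rightarrow> ('a \<Rightarrow> 'b) \<Rightarrow> real" where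
  "L2_inner M f g = (LINT x|M. f x \<bullet> g x)"

definition L2_norm :: "'a measure \<Rightarrow> ('a \<Rightarrow> 'b::euclidean_space) \<Rightarrow> real" where
  "L2_norm M f = sqrt (LINT x|M. (norm (f x))\<^sup>2)"

text \<open>Differentiability of a curve of fields in the norm of \<open>L\<^sup>2(M)\<close>.\<close>

definition has_L2_deriv ::
  "'a measure \<Rightarrow> (real \<Rightarrow> 'a \<Rightarrow> 'b::euclidean_space) \<Rightarrow> ('a \<Rightarrow> 'b) \<Rightarrow> real \<Rightarrow> bool" where
  "has_L2_deriv M F F' t \<longleftrightarrow>
     (\<forall>\<^sub>F s in nhds t. L2 M (F s)) \<and> L2 M F' \<and>
     ((\<lambda>h. L2_norm M (\<lambda>x. (F (t + h) x - F t x) /\<^sub>R h - F' x)) \<longlongrightarrow> 0) (at 0)"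


section \<open>Weak gradients and \<open>H\<^sup>1\<close> on open sets\<close>

definition grad :: "(real^'d \<Rightarrow> real) \<Rightarrow> real^'d \<Rightarrow> real^'d" where
  "grad f x = (\<chi> i. frechet_derivative f (at x) (axis i 1))"

primrec Ck :: "nat \<Rightarrow> (real^'d \<Rightarrow> real) \<Rightarrow> bool" where
  "Ck 0 f \<longleftrightarrow> continuous_on UNIV f"
| "Ck (Suc k) f \<longleftrightarrow> f differentiable_on UNIV \<and> (\<forall>i. Ck k (\<lambda>x. grad f x $ i))"

definition smooth :: "(real^'d \<Rightarrow> real) \<Rightarrow> bool" where
  "smooth f \<longleftrightarrow> (\<forall>k. Ck k f)"

definition test_function :: "(real^'d) set \<Rightarrow> (real^'d \<Rightarrow> real) \<Rightarrow> bool" where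
  "test_function U \<phi> \<longleftrightarrow> smooth \<phi> \<and> compact (closure {x. \<phi> x \<noteq> 0}) \<and> closure {x. \<phi> x \<noteq> 0} \<subseteq> U"

definition weak_gradient :: "(real^'d) set \<Rightarrow> (real^'d \<Rightarrow> real) \<Rightarrow> (real^'d \<Rightarrow> real^'d) \<Rightarrow> bool" where
  "weak_gradient U f g \<longleftrightarrow> L2 (lebesgue_on U) g \<and>
     (\<forall>\<phi>. test_function U \<phi> \<longrightarrow>
        (LINT x|lebesgue_on U. f x *\<^sub>R grad \<phi> x) = - (LINT x|lebesgue_on U. \<phi> x *\<^sub>R g x))"

definition H1 :: "(real^'d) set \<Rightarrow> (real^'d \<Rightarrow> real) \<Rightarrow> bool" where
  "H1 U f \<longleftrightarrow> L2 (lebesgue_on U) f \<and> (\<exists>g. weak_gradient U f g)"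

text \<open>A representative; weak gradients are unique up to null sets.\<close>

definition wgrad :: "(real^'d) set \<Rightarrow> (real^'d \<Rightarrow> real) \<Rightarrow> real^'d \<Rightarrow> real^'d" where
  "wgrad U f = (SOME g. weak_gradient U f g)"

definition H1_vec :: "(real^'d) set \<Rightarrow> (real^'d \<Rightarrow> real^'d) \<Rightarrow> bool" where
  "H1_vec U v \<longleftrightarrow> (\<forall>i. H1 U (\<lambda>x. v x $ i))"

definition wjac :: "(real^'d) set \<Rightarrow> (real^'d \<Rightarrow> real^'d) \<Rightarrow> real^'d \<Rightarrow> real^'d^'d" where
  "wjac U v x = (\<chi> i. wgrad U (\<lambda>y. v y $ i) x)"

definition wdiv :: "(real^'d) set \<Rightarrow> (real^'d \<Rightarrow> real^'d) \<Rightarrow> real^'d \<Rightarrow> real" where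
  "wdiv U v x = (\<Sum>i\<in>UNIV. wjac U v x $ i $ i)"

definition strain :: "(real^'d) set \<Rightarrow> (real^'d \<Rightarrow> real^'d) \<Rightarrow> real^'d \<Rightarrow> real^'d^'d" where
  "strain U v x = (1/2) *\<^sub>R (wjac U v x + transpose (wjac U v x))"


section \<open>Polygonal surfaces and surface measure\<close>

text \<open>
  A polygonal surface is given by its facets, which meet face to face. Any finite union of
  \<open>(d-1)\<close>-dimensional polytopes can be subdivided in this way.
\<close>

definition polygonal_surface :: "(real^'d) set set \<Rightarrow> bool" where
  "polygonal_surface Fs \<longleftrightarrow> finite Fs \<and>
     (\<forall>F\<in>Fs. polytope F \<and> aff_dim F = int CARD('d) - 1) \<and>
     (\<forall>F\<in>Fs. \<forall>F'\<in>Fs. (F \<inter> F') face_of F \<and> (F \<inter> F') face_of F')"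

definition unit_normal :: "(real^'d) set \<Rightarrow> real^'d \<Rightarrow> bool" where
  "unit_normal F \<nu> \<longleftrightarrow> norm \<nu> = 1 \<and> (\<exists>b. \<forall>x\<in>F. \<nu> \<bullet> x = b)"

definition facet_normal :: "(real^'d) set \<Rightarrow> real^'d" where
  "facet_normal F = (SOME \<nu>. unit_normal F \<nu>)"

text \<open>
  The \<open>(d-1)\<close>-dimensional area of a subset of a facet is the volume of the right prism of
  height 1 over it (Cavalieri); it does not depend on the choice of the unit normal.
\<close>

definition prism :: "(real^'d) set \<Rightarrow> (real^'d) set \<Rightarrow> (real^'d) set" where
  "prism F A = {x + s *\<^sub>R facet_normal F | x s. x \<in> A \<inter> F \<and> 0 \<le> s \<and> s \<le> 1}"

definition surface_measure :: "(real^'d) set set \<Rightarrow> (real^'d) measure" where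
  "surface_measure Fs =
     completion (measure_of UNIV (sets borel) (\<lambda>A. \<Sum>F\<in>Fs. emeasure lborel (prism F A)))"

lemma ex_unit_normal:
  fixes F :: "(real^'d) set"
  assumes "aff_dim F = int CARD('d) - 1"
  shows "\<exists>\<nu>. unit_normal F \<nu>"
proof -
  obtain a b where a: "a \<noteq> 0" and H: "affine hull F = {x. a \<bullet> x = b}"
    using assms aff_dim_eq_hyperplane[of F] by auto
  have "unit_normal F (a /\<^sub>R norm a)"
    unfolding unit_normal_def
  proof (intro conjI exI ballI)
    show "norm (a /\<^sub>R norm a) = 1" using a by simp
    fix x assume "x \<in> F"
    then have "x \<in> affine hull F" by (rule hull_inc)
    then show "(a /\<^sub>R norm a) \<bullet> x = b / norm a"
      by (simp add: H field_simps)
  qed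
  then show ?thesis by blast
qed

lemma prism_eq_vimage:
  fixes F :: "(real^'d) set"
  assumes "unit_normal F (facet_normal F)"
  shows "\<exists>b. \<forall>A. prism F A =
    {y. y - (facet_normal F \<bullet> y - b) *\<^sub>R facet_normal F \<in> A \<inter> F \<and>
        0 \<le> facet_normal F \<bullet> y - b \<and> facet_normal F \<bullet> y - b \<le> 1}"
proof -
  let ?n = "facet_normal F"
  obtain b where n1: "?n \<bullet> ?n = 1" and b: "\<And>x. x \<in> F \<Longrightarrow> ?n \<bullet> x = b"
    using assms by (auto simp: unit_normal_def norm_eq_1)
  have "prism F A = {y. y - (?n \<bullet> y - b) *\<^sub>R ?n \<in> A \<inter> F \<and> 0 \<le> ?n \<bullet> y - b \<and> ?n \<bullet> y - b \<le> 1}" for A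
  proof (intro set_eqI iffI)
    fix y assume "y \<in> prism F A"
    then show "y \<in> {y. y - (?n \<bullet> y - b) *\<^sub>R ?n \<in> A \<inter> F \<and> 0 \<le> ?n \<bullet> y - b \<and> ?n \<bullet> y - b \<le> 1}"
      by (auto simp: prism_def inner_add_right n1 b)
  next
    fix y assume *: "y \<in> {y. y - (?n \<bullet> y - b) *\<^sub>R ?n \<in> A \<inter> F \<and> 0 \<le> ?n \<bullet> y - b \<and> ?n \<bullet> y - b \<le> 1}"
    show "y \<in> prism F A"
      unfolding prism_def mem_Collect_eq
      by (rule exI[of _ "y - (?n \<bullet> y - b) *\<^sub>R ?n"], rule exI[of _ "?n \<bullet> y - b"]) (use * in auto)
  qed
  then show ?thesis by blast
qed

lemma emeasure_surface_measure:
  fixes Fs :: "(real^'d) set set"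
  assumes Fs: "polygonal_surface Fs" and A: "A \<in> sets borel"
  shows "emeasure (surface_measure Fs) A = (\<Sum>F\<in>Fs. emeasure lborel (prism F A))"
proof -
  have "\<forall>F\<in>Fs. \<exists>b. \<forall>A. prism F A =
    {y. y - (facet_normal F \<bullet> y - b) *\<^sub>R facet_normal F \<in> A \<inter> F \<and>
        0 \<le> facet_normal F \<bullet> y - b \<and> facet_normal F \<bullet> y - b \<le> 1}"
  proof (rule ballI, rule prism_eq_vimage)
    fix F assume "F \<in> Fs"
    show "unit_normal F (facet_normal F)"
      unfolding facet_normal_def
      by (rule someI_ex, rule ex_unit_normal) (use Fs \<open>F \<in> Fs\<close> in \<open>simp add: polygonal_surface_def\<close>)
  qed
  from bchoice[OF this] obtain b where Pb: "\<forall>F\<in>Fs. \<forall>A. prism F A =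
    {y. y - (facet_normal F \<bullet> y - b F) *\<^sub>R facet_normal F \<in> A \<inter> F \<and>
        0 \<le> facet_normal F \<bullet> y - b F \<and> facet_normal F \<bullet> y - b F \<le> 1}"
    by (rule exE)
  note P = Pb[THEN bspec, THEN spec]
  have meas: "prism F A \<in> sets lborel" if F: "F \<in> Fs" and A: "A \<in> sets borel" for F A
  proof -
    have "F \<in> sets borel"
      by (rule borel_closed, rule polytope_imp_closed) (use Fs F in \<open>simp add: polygonal_surface_def\<close>)
    with A have AF: "A \<inter> F \<in> sets borel" by blast
    have *: "(\<lambda>y. y - (facet_normal F \<bullet> y - b F) *\<^sub>R facet_normal F) \<in> borel_measurable borel"
      by measurable
    have "(\<lambda>y. y - (facet_normal F \<bullet> y - b F) *\<^sub>R facet_normal F) -` (A \<inter> F) \<in> sets borel"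
      using measurable_sets[OF * AF] by simp
    moreover have "{y. 0 \<le> facet_normal F \<bullet> y - b F \<and> facet_normal F \<bullet> y - b F \<le> 1} \<in> sets borel"
      by measurable
    ultimately have "(\<lambda>y. y - (facet_normal F \<bullet> y - b F) *\<^sub>R facet_normal F) -` (A \<inter> F) \<inter>
        {y. 0 \<le> facet_normal F \<bullet> y - b F \<and> facet_normal F \<bullet> y - b F \<le> 1} \<in> sets borel"
      by (rule sets.Int)
    also have "(\<lambda>y. y - (facet_normal F \<bullet> y - b F) *\<^sub>R facet_normal F) -` (A \<inter> F) \<inter>
        {y. 0 \<le> facet_normal F \<bullet> y - b F \<and> facet_normal F \<bullet> y - b F \<le> 1} = prism F A"
      by (auto simp: P[OF F])
    finally show ?thesis by simp
  qed
  let ?\<mu> = "\<lambda>A. \<Sum>F\<in>Fs. emeasure lborel (prism F A)"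
  have pos: "positive (sets borel) ?\<mu>"
    by (simp add: positive_def prism_def)
  have ca: "countably_additive (sets borel) ?\<mu>"
  proof (rule countably_additiveI)
    fix B :: "nat \<Rightarrow> (real^'d) set"
    assume B: "range B \<subseteq> sets borel" "disjoint_family B"
    have "(\<Sum>i. emeasure lborel (prism F (B i))) = emeasure lborel (prism F (\<Union>i. B i))"
      if F: "F \<in> Fs" for F
    proof -
      have "(\<Sum>i. emeasure lborel (prism F (B i))) = emeasure lborel (\<Union>i. prism F (B i))"
      proof (rule suminf_emeasure)
        show "range (\<lambda>i. prism F (B i)) \<subseteq> sets lborel" 
          by (rule image_subsetI, rule meas[OF F]) (use B(1) in auto)
        show "disjoint_family (\<lambda>i. prism F (B i))"
          using B(2) by (auto simp: disjoint_family_on_def P[OF F])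
      qed
      also have "(\<Union>i. prism F (B i)) = prism F (\<Union>i. B i)"
        by (auto simp: P[OF F])
      finally show ?thesis .
    qed
    then show "(\<Sum>i. ?\<mu> (B i)) = ?\<mu> (\<Union>i. B i)"
      by (subst suminf_sum) (auto intro!: sum.cong)
  qed
  let ?M = "measure_of UNIV (sets borel) ?\<mu>"
  have sM: "sets ?M = sets borel"
    using sets.sets_measure_of_eq[of borel] by simp
  have "emeasure ?M A = ?\<mu> A"
  proof (rule emeasure_measure_of_sigma[OF _ pos ca A])
    show "sigma_algebra UNIV (sets (borel :: (real^'d) measure))"
      using sets.sigma_algebra_axioms[of borel] by simp
  qed
  then show ?thesis
    using A sM by (simp add: surface_measure_def)
qed

definition polyhedral_domain :: "(real^'d) set \<Rightarrow> (real^'d) set set \<Rightarrow> bool" where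
  "polyhedral_domain \<Omega> Bs \<longleftrightarrow> open \<Omega> \<and> connected \<Omega> \<and> \<Omega> \<noteq> {} \<and> bounded \<Omega> \<and>
     polygonal_surface Bs \<and> frontier \<Omega> = \<Union>Bs"

text \<open>
  The \<open>+\<close> side of a facet \<open>F\<close> is the one the unit normal \<open>\<nu> F\<close> points away from.
\<close>

definition fracture :: "(real^'d) set \<Rightarrow> (real^'d) set set \<Rightarrow> ((real^'d) set \<Rightarrow> real^'d) \<Rightarrow> bool" where
  "fracture \<Omega> Cs \<nu> \<longleftrightarrow> polygonal_surface Cs \<and> \<Union>Cs \<subseteq> \<Omega> \<and> (\<forall>F\<in>Cs. unit_normal F (\<nu> F))"

text \<open>
  The normal \<open>n\<^sup>+\<close> as a field on the fracture. The choice only matters on intersections of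
  facets, which have surface measure zero.
\<close>

definition normal_field :: "(real^'d) set set \<Rightarrow> ((real^'d) set \<Rightarrow> real^'d) \<Rightarrow> real^'d \<Rightarrow> real^'d" where
  "normal_field Cs \<nu> x = \<nu> (SOME F. F \<in> Cs \<and> x \<in> F)"

text \<open>The boundary of the surface: the ridges that belong to exactly one facet.\<close>

definition surface_boundary :: "(real^'d) set set \<Rightarrow> (real^'d) set" where
  "surface_boundary Cs = \<Union>{R. \<exists>!F. F \<in> Cs \<and> R facet_of F}"


section \<open>Traces\<close>

text \<open>
  Traces are limits of means: \<open>g\<close> is the value of \<open>f\<close> at \<open>x\<close> as seen from \<open>D\<close> if
  \<open>r\<^sup>-\<^sup>k \<integral>\<^bsub>D \<inter> B(x,r)\<^esub> |f - g|\<close> tends to 0, where \<open>k\<close> is the dimension of \<open>D\<close>. For Sobolev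
  functions this holds at almost every point of a facet, with \<open>g\<close> the usual trace. It does
  not depend on the representative of \<open>f\<close>.
\<close>

definition mean_limit ::
  "(real^'d) measure \<Rightarrow> nat \<Rightarrow> (real^'d \<Rightarrow> 'b::euclidean_space) \<Rightarrow> real^'d \<Rightarrow> 'b \<Rightarrow> bool" where
  "mean_limit M k f x g \<longleftrightarrow>
     (\<forall>\<^sub>F r in at_right 0. set_integrable M (ball x r) f) \<and>
     ((\<lambda>r. (LINT y:ball x r|M. norm (f y - g)) / r ^ k) \<longlongrightarrow> 0) (at_right 0)"

definition has_trace ::
  "(real^'d) set \<Rightarrow> (real^'d \<Rightarrow> 'b::euclidean_space) \<Rightarrow> real^'d \<Rightarrow> 'b \<Rightarrow> bool" where
  "has_trace D f x g \<longleftrightarrow> mean_limit (lebesgue_on D) CARD('d) f x g"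

definition trace_on :: "(real^'d) set \<Rightarrow> (real^'d \<Rightarrow> 'b::euclidean_space) \<Rightarrow> real^'d \<Rightarrow> 'b" where
  "trace_on D f x = (THE g. has_trace D f x g)"

definition plus_side :: "(real^'d) set \<Rightarrow> (real^'d \<Rightarrow> real^'d) \<Rightarrow> real^'d \<Rightarrow> (real^'d) set" where
  "plus_side U n x = {y \<in> U. (y - x) \<bullet> n x < 0}"

definition minus_side :: "(real^'d) set \<Rightarrow> (real^'d \<Rightarrow> real^'d) \<Rightarrow> real^'d \<Rightarrow> (real^'d) set" where
  "minus_side U n x = {y \<in> U. (y - x) \<bullet> n x > 0}"

definition trace_plus ::
  "(real^'d) set \<Rightarrow> (real^'d \<Rightarrow> real^'d) \<Rightarrow> (real^'d \<Rightarrow> 'b::euclidean_space) \<Rightarrow> real^'d \<Rightarrow> 'b" where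
  "trace_plus U n f x = trace_on (plus_side U n x) f x"

definition trace_minus ::
  "(real^'d) set \<Rightarrow> (real^'d \<Rightarrow> real^'d) \<Rightarrow> (real^'d \<Rightarrow> 'b::euclidean_space) \<Rightarrow> real^'d \<Rightarrow> 'b" where
  "trace_minus U n f x = trace_on (minus_side U n x) f x"

definition jump ::
  "(real^'d) set \<Rightarrow> (real^'d \<Rightarrow> real^'d) \<Rightarrow> (real^'d \<Rightarrow> 'b::euclidean_space) \<Rightarrow> real^'d \<Rightarrow> 'b" where
  "jump U n f x = trace_plus U n f x - trace_minus U n f x"

definition normal_jump ::
  "(real^'d) set \<Rightarrow> (real^'d \<Rightarrow> real^'d) \<Rightarrow> (real^'d \<Rightarrow> real^'d) \<Rightarrow> real^'d \<Rightarrow> real" where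
  "normal_jump U n v x = jump U n v x \<bullet> n x"

definition has_two_traces ::
  "(real^'d) set \<Rightarrow> (real^'d) measure \<Rightarrow> (real^'d \<Rightarrow> real^'d) \<Rightarrow> (real^'d \<Rightarrow> 'b::euclidean_space) \<Rightarrow> bool" where
  "has_two_traces U S n f \<longleftrightarrow>
     (AE x in S. (\<exists>g. has_trace (plus_side U n x) f x g) \<and> (\<exists>g. has_trace (minus_side U n x) f x g))"


section \<open>\<open>H\<^sup>1\<close> on the fracture\<close>

definition tangential :: "real^'d \<Rightarrow> real^'d \<Rightarrow> real^'d" where
  "tangential \<nu> v = v - (v \<bullet> \<nu>) *\<^sub>R \<nu>"

text \<open>
  \<open>H\<^sup>1(C)\<close> is the closure of the restrictions of smooth functions in the norm of the function
  and its tangential gradient; equivalently, the facetwise \<open>H\<^sup>1\<close> functions whose traces agree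
  on common ridges. \<open>S\<close> is the surface measure and \<open>n\<close> the normal field of \<open>C\<close>.
\<close>

definition surface_gradient ::
  "(real^'d) measure \<Rightarrow> (real^'d \<Rightarrow> real^'d) \<Rightarrow> (real^'d \<Rightarrow> real) \<Rightarrow> (real^'d \<Rightarrow> real^'d) \<Rightarrow> bool" where
  "surface_gradient S n q g \<longleftrightarrow> L2 S g \<and>
     (\<exists>\<phi> :: nat \<Rightarrow> real^'d \<Rightarrow> real. (\<forall>k. smooth (\<phi> k)) \<and>
        (\<lambda>k. L2_norm S (\<lambda>x. \<phi> k x - q x)) \<longlonglongrightarrow> 0 \<and>
        (\<lambda>k. L2_norm S (\<lambda>x. tangential (n x) (grad (\<phi> k) x) - g x)) \<longlonglongrightarrow> 0)"

definition H1_surf :: "(real^'d) measure \<Rightarrow> (real^'d \<Rightarrow> real^'d) \<Rightarrow> (real^'d \<Rightarrow> real) \<Rightarrow> bool" where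
  "H1_surf S n q \<longleftrightarrow> L2 S q \<and> (\<exists>g. surface_gradient S n q g)"

definition sgrad :: "(real^'d) measure \<Rightarrow> (real^'d \<Rightarrow> real^'d) \<Rightarrow> (real^'d \<Rightarrow> real) \<Rightarrow> real^'d \<Rightarrow> real^'d" where
  "sgrad S n q = (SOME g. surface_gradient S n q g)"


section \<open>Function spaces, coefficients and energy of the poroelastic model\<close>

text \<open>
  In this section \<open>U = \<Omega> \<setminus> C\<close>, and \<open>S\<close>, \<open>n\<close> are the surface measure and the normal field of \<open>C\<close>.
\<close>

definition displacement_space :: "(real^'d) set \<Rightarrow> (real^'d) set set \<Rightarrow> (real^'d \<Rightarrow> real^'d) \<Rightarrow> bool" where
  "displacement_space U Bs v \<longleftrightarrow> H1_vec U v \<and> (AE x in surface_measure Bs. has_trace U v x 0)"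

definition pressure_space ::
  "(real^'d) set \<Rightarrow> (real^'d) measure \<Rightarrow> (real^'d \<Rightarrow> real^'d) \<Rightarrow> (real^'d \<Rightarrow> real) \<Rightarrow> bool" where
  "pressure_space \<Omega> S n q \<longleftrightarrow> H1 \<Omega> q \<and> H1_surf S n (trace_on \<Omega> q)"

text \<open>
  Differentiability of a curve in \<open>H\<^sup>1(U)\<^sup>d\<close>. The traces are listed as part of the norm; by
  the trace inequality this gives an equivalent norm.
\<close>

definition has_H1_deriv ::
  "(real^'d) set \<Rightarrow> (real^'d) measure \<Rightarrow> (real^'d \<Rightarrow> real^'d) \<Rightarrow>
   (real \<Rightarrow> real^'d \<Rightarrow> real^'d) \<Rightarrow> (real^'d \<Rightarrow> real^'d) \<Rightarrow> real \<Rightarrow> bool" where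
  "has_H1_deriv U S n w w' t \<longleftrightarrow>
     has_L2_deriv (lebesgue_on U) w w' t \<and>
     has_L2_deriv (lebesgue_on U) (\<lambda>s. wjac U (w s)) (wjac U w') t \<and>
     has_L2_deriv S (\<lambda>s. trace_plus U n (w s)) (trace_plus U n w') t \<and>
     has_L2_deriv S (\<lambda>s. trace_minus U n (w s)) (trace_minus U n w') t"

definition fracture_width ::
  "(real^'d) set \<Rightarrow> (real^'d \<Rightarrow> real^'d) \<Rightarrow> (real^'d \<Rightarrow> real^'d) \<Rightarrow> real^'d \<Rightarrow> real" where
  "fracture_width U n w x = - normal_jump U n w x"

text \<open>\<open>K = k I\<close> with a positive scalar field \<open>k\<close>; \<open>mat c\<close> is \<open>c\<close> times the identity.\<close>

definition scalar_permeability ::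
  "(real^'d) measure \<Rightarrow> (real^'d) set \<Rightarrow> (real^'d \<Rightarrow> real^'d^'d) \<Rightarrow> bool" where
  "scalar_permeability M D K \<longleftrightarrow>
     (\<exists>k B. k \<in> borel_measurable M \<and> (\<forall>x\<in>D. 0 < k x \<and> k x \<le> B \<and> K x = mat (k x)))"

definition mobility :: "real \<Rightarrow> (real^'d \<Rightarrow> real^'d^'d) \<Rightarrow> real^'d \<Rightarrow> real^'d^'d" where
  "mobility \<eta> K x = (1 / \<eta>) *\<^sub>R K x"

definition mat_sqrt :: "real^'d^'d \<Rightarrow> real^'d^'d" where
  "mat_sqrt A = (THE B. transpose B = B \<and> (\<forall>v. 0 \<le> v \<bullet> (B *v v)) \<and> B ** B = A)"

definition total_energy ::
  "(real^'d) set \<Rightarrow> (real^'d) measure \<Rightarrow> real \<Rightarrow> real \<Rightarrow> real \<Rightarrow> real \<Rightarrow> real \<Rightarrow>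
   (real^'d \<Rightarrow> real^'d) \<Rightarrow> (real^'d \<Rightarrow> real) \<Rightarrow> (real^'d \<Rightarrow> real) \<Rightarrow> (real^'d \<Rightarrow> real) \<Rightarrow> real" where
  "total_energy U S lam G \<alpha> c\<^sub>0 c\<^sub>f w p \<xi> p\<^sub>c =
     1/2 * (LINT x|lebesgue_on U. 2 * G * (strain U w x \<bullet> strain U w x)) +
     1/2 * (LINT x|lebesgue_on U. 1 / lam * (\<alpha> * p x - \<xi> x)\<^sup>2) +
     1/2 * (LINT x|lebesgue_on U. c\<^sub>0 * (p x)\<^sup>2) +
     1/2 * (LINT x|S. c\<^sub>f * (p\<^sub>c x)\<^sup>2)"

end

theory Submission
  imports Defs
begin

text \<open>
  Test the momentum balance with \<open>\<partial>\<^sub>t w\<close>, the time derivative of the total pressure equation with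
  \<open>\<xi>\<close>, and the two mass balances with \<open>p\<close> and \<open>p\<^sub>c\<close>. In the sum the normal flux jumps cancel
  because \<open>p = p\<^sub>c\<close> on the fracture, and \<open>(p\<^sub>c, [\<partial>\<^sub>t w] \<cdot> n\<^sup>+)\<close> cancels \<open>(\<partial>\<^sub>t w\<^sub>f, p\<^sub>c)\<close>; what is left of
  the time derivatives is the derivative of the energy. Equations are differentiated in time only
  after pairing them with a fixed \<open>L\<^sup>2\<close> function, so that the product rule for the \<open>L\<^sup>2\<close> inner product
  and uniqueness of real derivatives suffice.
\<close>

section \<open>Calculus in \<open>L\<^sup>2\<close>\<close>

lemma L2_measurable: "L2 M f \<Longrightarrow> f \<in> borel_measurable M"
  by (simp add: L2_def)

text \<open>Cauchy-Schwarz in the value space bounds the integrand by the product of the norms, and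
  expanding \<open>0 \<le> (norm a - norm b)\<^sup>2\<close> bounds that product by the sum of the
  squares.\<close>

lemma L2_inner_integrable:
  assumes "L2 M f" "L2 M g"
  shows "integrable M (\<lambda>x. f x \<bullet> g x)"
proof (rule Bochner_Integration.integrable_bound)
  show "integrable M (\<lambda>x. (norm (f x))\<^sup>2 + (norm (g x))\<^sup>2)"
    using assms by (simp add: L2_def)
  show "(\<lambda>x. f x \<bullet> g x) \<in> borel_measurable M"
    using assms by (intro borel_measurable_inner L2_measurable)
  have "\<bar>a \<bullet> b\<bar> \<le> (norm a)\<^sup>2 + (norm b)\<^sup>2" for a b :: 'b
  proof -
    have "0 \<le> (norm a - norm b)\<^sup>2" by simp
    moreover have "0 \<le> norm a * norm b" by simp
    ultimately show ?thesis
      using Cauchy_Schwarz_ineq2[of a b] unfolding power2_diff by linarith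
  qed
  then show "AE x in M. norm (f x \<bullet> g x) \<le> norm ((norm (f x))\<^sup>2 + (norm (g x))\<^sup>2)"
    by (intro AE_I2) simp
qed

lemma L2I:
  assumes "f \<in> borel_measurable M" "integrable M (\<lambda>x. f x \<bullet> f x)"
  shows "L2 M f"
  using assms by (simp add: L2_def power2_norm_eq_inner)

lemma L2_add:
  assumes "L2 M f" "L2 M g"
  shows "L2 M (\<lambda>x. f x + g x)"
proof (rule L2I)
  show "(\<lambda>x. f x + g x) \<in> borel_measurable M"
    using assms by (intro borel_measurable_add L2_measurable)
  show "integrable M (\<lambda>x. (f x + g x) \<bullet> (f x + g x))"
    unfolding inner_add_left inner_add_right
    using assms by (intro Bochner_Integration.integrable_add L2_inner_integrable)
qed

text \<open>Serves scalar multiples as well as the strain and the divergence, which are pointwise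
  linear images of the weak Jacobian.\<close>

lemma L2_bounded_linear:
  assumes "bounded_linear A" "L2 M f"
  shows "L2 M (\<lambda>x. A (f x))"
proof -
  interpret bounded_linear A by fact
  obtain B where B: "\<And>x. norm (A x) \<le> norm x * B"
    using bounded by blast
  have meas: "(\<lambda>x. A (f x)) \<in> borel_measurable M"
    by (rule borel_measurable_continuous_on[OF linear_continuous_on[OF assms(1)]])
      (use assms(2) in \<open>rule L2_measurable\<close>)
  have "integrable M (\<lambda>x. (norm (A (f x)))\<^sup>2)"
  proof (rule Bochner_Integration.integrable_bound)
    show "integrable M (\<lambda>x. B\<^sup>2 * (norm (f x))\<^sup>2)"
      using assms(2) by (simp add: L2_def)
    show "(\<lambda>x. (norm (A (f x)))\<^sup>2) \<in> borel_measurable M"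
      using meas by measurable
    have "(norm (A y))\<^sup>2 \<le> B\<^sup>2 * (norm y)\<^sup>2" for y
      using power_mono[OF B[of y], of 2] by (simp add: power_mult_distrib mult.commute)
    then show "AE x in M. norm ((norm (A (f x)))\<^sup>2) \<le> norm (B\<^sup>2 * (norm (f x))\<^sup>2)"
      by (intro AE_I2) simp
  qed
  with meas show ?thesis
    by (simp add: L2_def)
qed

lemma L2_scaleR: "L2 M f \<Longrightarrow> L2 M (\<lambda>x. c *\<^sub>R f x)"
  by (rule L2_bounded_linear[OF bounded_linear_scaleR_right])

lemma L2_diff:
  assumes "L2 M f" "L2 M g"
  shows "L2 M (\<lambda>x. f x - g x)"
  using L2_add[OF assms(1) L2_scaleR[OF assms(2), of "-1"]] by simp

section \<open>The inner product as a positive semidefinite bilinear form\<close>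

lemma L2_inner_commute: "L2_inner M f g = L2_inner M g f"
  by (simp add: L2_inner_def inner_commute)

lemma L2_inner_add_left:
  assumes "L2 M f" "L2 M g" "L2 M h"
  shows "L2_inner M (\<lambda>x. f x + g x) h = L2_inner M f h + L2_inner M g h"
  using assms by (simp add: L2_inner_def inner_add_left L2_inner_integrable)

lemma L2_inner_add_right:
  assumes "L2 M f" "L2 M g" "L2 M h"
  shows "L2_inner M h (\<lambda>x. f x + g x) = L2_inner M h f + L2_inner M h g"
  using assms by (simp add: L2_inner_def inner_add_right L2_inner_integrable)

lemma L2_inner_diff_left:
  assumes "L2 M f" "L2 M g" "L2 M h"
  shows "L2_inner M (\<lambda>x. f x - g x) h = L2_inner M f h - L2_inner M g h"
  using assms by (simp add: L2_inner_def inner_diff_left L2_inner_integrable)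

lemma L2_inner_scaleR_left: "L2_inner M (\<lambda>x. c *\<^sub>R f x) g = c * L2_inner M f g"
  by (simp add: L2_inner_def)

lemma L2_inner_scaleR_right: "L2_inner M f (\<lambda>x. c *\<^sub>R g x) = c * L2_inner M f g"
  by (simp add: L2_inner_def)

lemma L2_norm_power2: "(L2_norm M f)\<^sup>2 = L2_inner M f f"
  by (simp add: L2_norm_def L2_inner_def power2_norm_eq_inner)

lemma L2_norm_nonneg: "0 \<le> L2_norm M f"
  by (simp add: L2_norm_def)

text \<open>Discriminant argument: the squared norm of \<open>r f + g\<close> is a quadratic
  polynomial in \<open>r\<close> that is nowhere negative. The form is only semidefinite on
  functions, and a vanishing leading coefficient is a case of its own.\<close>

lemma L2_Cauchy_Schwarz:
  assumes f: "L2 M f" and g: "L2 M g"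
  shows "\<bar>L2_inner M f g\<bar> \<le> L2_norm M f * L2_norm M g"
proof -
  define a b c where "a = L2_inner M f f" and "b = L2_inner M f g" and "c = L2_inner M g g"
  have q: "0 \<le> r\<^sup>2 * a + 2 * r * b + c" for r
  proof -
    have "0 \<le> L2_inner M (\<lambda>x. r *\<^sub>R f x + g x) (\<lambda>x. r *\<^sub>R f x + g x)"
      by (simp add: L2_inner_def)
    also have "\<dots> = r\<^sup>2 * a + 2 * r * b + c"
      using f g L2_inner_commute[of M g f]
      by (simp only: L2_inner_add_left L2_inner_add_right L2_add L2_scaleR
          L2_inner_scaleR_left L2_inner_scaleR_right a_def b_def c_def)
        (simp add: power2_eq_square algebra_simps)
    finally show ?thesis .
  qed
  have a: "0 \<le> a" by (simp add: a_def L2_inner_def)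
  have "b\<^sup>2 \<le> a * c"
  proof (cases "a = 0")
    case True
    have "b = 0"
    proof (rule ccontr)
      assume "b \<noteq> 0"
      \<comment> \<open>With \<open>a = 0\<close> the polynomial is linear in \<open>r\<close>; this
        \<open>r\<close> gives it the value -1.\<close>
      then show False
        using q[of "- (c + 1) / (2 * b)"] True by (simp add: field_simps)
    qed
    then show ?thesis using True by simp
  next
    case False
    \<comment> \<open>The polynomial is evaluated at its minimizer \<open>- b / a\<close> and
      multiplied by \<open>a\<close>.\<close>
    then have "0 \<le> a * ((- b / a)\<^sup>2 * a + 2 * (- b / a) * b + c)"
      using q[of "- b / a"] a by simp
    also have "\<dots> = a * c - b\<^sup>2"
      using False by (simp add: field_simps power2_eq_square)
    finally show ?thesis by simp
  qed
  also have "a * c = (L2_norm M f * L2_norm M g)\<^sup>2"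
    by (simp add: power_mult_distrib L2_norm_power2 a_def c_def)
  finally show ?thesis
    unfolding b_def by (simp add: abs_le_square_iff[symmetric] L2_norm_nonneg)
qed

text \<open>One constant serves all functions, so it can be applied to remainders that vary with the
  increment \<open>h\<close>.\<close>

lemma L2_norm_bounded_linear_le:
  fixes A :: "'a::euclidean_space \<Rightarrow> 'b::euclidean_space"
  assumes "bounded_linear A"
  obtains B where "0 \<le> B" "\<And>f M. L2 M f \<Longrightarrow> L2_norm M (\<lambda>x. A (f x)) \<le> B * L2_norm M f"
proof -
  obtain B where B: "0 \<le> B" "\<And>x. norm (A x) \<le> norm x * B"
    using bounded_linear.nonneg_bounded[OF assms] by blast
  show ?thesis
  proof
    fix f :: "'c \<Rightarrow> 'a" and M
    assume f: "L2 M f"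
    have "(LINT x|M. (norm (A (f x)))\<^sup>2) \<le> (LINT x|M. B\<^sup>2 * (norm (f x))\<^sup>2)"
    proof (rule integral_mono)
      show "integrable M (\<lambda>x. (norm (A (f x)))\<^sup>2)" "integrable M (\<lambda>x. B\<^sup>2 * (norm (f x))\<^sup>2)"
        using f L2_bounded_linear[OF assms f] by (simp_all add: L2_def)
      show "(norm (A (f x)))\<^sup>2 \<le> B\<^sup>2 * (norm (f x))\<^sup>2" for x
        using power_mono[OF B(2)[of "f x"], of 2] by (simp add: power_mult_distrib mult.commute)
    qed
    then have "L2_norm M (\<lambda>x. A (f x)) \<le> sqrt (B\<^sup>2 * (LINT x|M. (norm (f x))\<^sup>2))"
      by (simp add: L2_norm_def)
    then show "L2_norm M (\<lambda>x. A (f x)) \<le> B * L2_norm M f"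
      using B(1) by (simp add: L2_norm_def real_sqrt_mult)
  qed (fact B(1))
qed

section \<open>Differentiable curves and the product rule\<close>

lemma has_L2_derivD:
  assumes "has_L2_deriv M F F' t"
  shows "\<forall>\<^sub>F s in nhds t. L2 M (F s)" "L2 M F'" "L2 M (F t)"
    "((\<lambda>h. L2_norm M (\<lambda>x. (F (t + h) x - F t x) /\<^sub>R h - F' x)) \<longlongrightarrow> 0) (at 0)"
    "\<forall>\<^sub>F h in at 0. L2 M (F (t + h))"
proof -
  show *: "\<forall>\<^sub>F s in nhds t. L2 M (F s)" "L2 M F'" 
    "((\<lambda>h. L2_norm M (\<lambda>x. (F (t + h) x - F t x) /\<^sub>R h - F' x)) \<longlongrightarrow> 0) (at 0)"
    using assms by (simp_all add: has_L2_deriv_def)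
  show "L2 M (F t)"
    using *(1) by (rule eventually_nhds_x_imp_x)
  have "filterlim (\<lambda>h. t + h) (nhds t) (at 0)"
    by (auto intro!: tendsto_eq_intros)
  with *(1) show "\<forall>\<^sub>F h in at 0. L2 M (F (t + h))"
    by (rule eventually_compose_filterlim)
qed

text \<open>By linearity the remainder of the image curve is \<open>A\<close> applied to the
  remainder of \<open>F\<close>, so its norm is squeezed to 0.\<close>

lemma has_L2_deriv_bounded_linear:
  assumes A: "bounded_linear A" and F: "has_L2_deriv M F F' t"
  shows "has_L2_deriv M (\<lambda>s x. A (F s x)) (\<lambda>x. A (F' x)) t"
  unfolding has_L2_deriv_def
proof (intro conjI)
  interpret bounded_linear A by fact
  note d = has_L2_derivD[OF F]
  show "\<forall>\<^sub>F s in nhds t. L2 M (\<lambda>x. A (F s x))"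
    using d(1) by eventually_elim (rule L2_bounded_linear[OF A])
  show "L2 M (\<lambda>x. A (F' x))"
    by (rule L2_bounded_linear[OF A d(2)])
  obtain B where B: "0 \<le> B" "\<And>f. L2 M f \<Longrightarrow> L2_norm M (\<lambda>x. A (f x)) \<le> B * L2_norm M f"
    using L2_norm_bounded_linear_le[OF A] by metis
  let ?R = "\<lambda>h x. (F (t + h) x - F t x) /\<^sub>R h - F' x"
  have lim: "((\<lambda>h. B * L2_norm M (?R h)) \<longlongrightarrow> 0) (at 0)"
    using tendsto_mult_right_zero[OF d(4)] .
  have "((\<lambda>h. L2_norm M (\<lambda>x. A (?R h x))) \<longlongrightarrow> 0) (at 0)"
  proof (rule tendsto_sandwich[OF _ _ tendsto_const lim])
    show "\<forall>\<^sub>F h in at 0. 0 \<le> L2_norm M (\<lambda>x. A (?R h x))"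
      by (simp add: L2_norm_nonneg)
    show "\<forall>\<^sub>F h in at 0. L2_norm M (\<lambda>x. A (?R h x)) \<le> B * L2_norm M (?R h)"
      using d(5) by eventually_elim (intro B(2) L2_diff L2_scaleR d(2,3))
  qed
  then show "((\<lambda>h. L2_norm M (\<lambda>x. (A (F (t + h) x) - A (F t x)) /\<^sub>R h - A (F' x))) \<longlongrightarrow> 0) (at 0)"
    by (simp add: diff scaleR)
qed

lemma has_L2_deriv_const: "L2 M g \<Longrightarrow> has_L2_deriv M (\<lambda>_. g) (\<lambda>_. 0) t"
  by (simp add: has_L2_deriv_def L2_norm_def L2_def)

text \<open>Cauchy-Schwarz. The convergent norm of \<open>Q\<close> covers both uses: a fixed
  function, and another remainder with \<open>c = 0\<close>.\<close>

lemma L2_inner_tendsto_zero: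
  assumes "\<forall>\<^sub>F h in A. L2 M (R h)" "\<forall>\<^sub>F h in A. L2 M (Q h)"
    and "((\<lambda>h. L2_norm M (R h)) \<longlongrightarrow> 0) A" "((\<lambda>h. L2_norm M (Q h)) \<longlongrightarrow> c) A"
  shows "((\<lambda>h. L2_inner M (R h) (Q h)) \<longlongrightarrow> 0) A"
proof (rule Lim_null_comparison)
  show "((\<lambda>h. L2_norm M (R h) * L2_norm M (Q h)) \<longlongrightarrow> 0) A"
    using tendsto_mult[OF assms(3,4)] by simp
  show "\<forall>\<^sub>F h in A. norm (L2_inner M (R h) (Q h)) \<le> L2_norm M (R h) * L2_norm M (Q h)"
    using assms(1,2) by eventually_elim (simp add: L2_Cauchy_Schwarz)
qed

text \<open>
  Expand both factors as \<open>F (t + h) = F t + h F' + h R\<close> with \<open>R\<close> tending to 0 in \<open>L\<^sup>2\<close>.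
\<close>

lemma has_real_derivative_L2_inner:
  assumes F: "has_L2_deriv M F F' t" and G: "has_L2_deriv M G G' t"
  shows "((\<lambda>s. L2_inner M (F s) (G s)) has_real_derivative
           L2_inner M F' (G t) + L2_inner M (F t) G') (at t)"
proof -
  note f = has_L2_derivD[OF F] and g = has_L2_derivD[OF G]
  define R where "R h x = (F (t + h) x - F t x) /\<^sub>R h - F' x" for h x
  define Q where "Q h x = (G (t + h) x - G t x) /\<^sub>R h - G' x" for h x
  have R: "\<forall>\<^sub>F h in at 0. L2 M (R h)"
    using f(5) unfolding R_def by eventually_elim (intro L2_diff L2_scaleR f(2,3))
  have Q: "\<forall>\<^sub>F h in at 0. L2 M (Q h)"
    using g(5) unfolding Q_def by eventually_elim (intro L2_diff L2_scaleR g(2,3))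
  have R0: "((\<lambda>h. L2_norm M (R h)) \<longlongrightarrow> 0) (at 0)" using f(4) by (simp add: R_def[abs_def])
  have Q0: "((\<lambda>h. L2_norm M (Q h)) \<longlongrightarrow> 0) (at 0)" using g(4) by (simp add: Q_def[abs_def])
  have lim_R: "((\<lambda>h. L2_inner M (R h) u) \<longlongrightarrow> 0) (at 0)" if "L2 M u" for u
    by (rule L2_inner_tendsto_zero[OF R _ R0 tendsto_const]) (simp add: that)
  have lim_Q: "((\<lambda>h. L2_inner M u (Q h)) \<longlongrightarrow> 0) (at 0)" if "L2 M u" for u
    by (subst L2_inner_commute, rule L2_inner_tendsto_zero[OF Q _ Q0 tendsto_const])
      (simp add: that)
  have lim_RQ: "((\<lambda>h. L2_inner M (R h) (Q h)) \<longlongrightarrow> 0) (at 0)"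
    by (rule L2_inner_tendsto_zero[OF R Q R0 Q0])
  \<comment> \<open>The factor \<open>h\<close> in the last line collects everything of second order
    in the increments.\<close>
  have expand: "(L2_inner M (F (t + h)) (G (t + h)) - L2_inner M (F t) (G t)) / h =
      L2_inner M F' (G t) + L2_inner M (R h) (G t) + (L2_inner M (F t) G' + L2_inner M (F t) (Q h))
      + h * (L2_inner M F' G' + L2_inner M F' (Q h) + (L2_inner M (R h) G' + L2_inner M (R h) (Q h)))"
    if h: "h \<noteq> 0" and L: "L2 M (R h)" "L2 M (Q h)" for h
  proof -
    have "F (t + h) = (\<lambda>x. F t x + h *\<^sub>R (F' x + R h x))"
      "G (t + h) = (\<lambda>x. G t x + h *\<^sub>R (G' x + Q h x))"
      using h by (simp_all add: R_def Q_def)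
    then have "L2_inner M (F (t + h)) (G (t + h)) =
      L2_inner M (\<lambda>x. F t x + h *\<^sub>R (F' x + R h x)) (\<lambda>x. G t x + h *\<^sub>R (G' x + Q h x))"
      by simp
    also have "\<dots> = L2_inner M (F t) (G t) + h * (L2_inner M (F t) G' + L2_inner M (F t) (Q h))
      + h * (L2_inner M F' (G t) + L2_inner M (R h) (G t))
      + h * h * (L2_inner M F' G' + L2_inner M F' (Q h) + (L2_inner M (R h) G' + L2_inner M (R h) (Q h)))"
      by (simp only: L2_inner_add_left L2_inner_add_right L2_add L2_scaleR f(2,3) g(2,3) L
          L2_inner_scaleR_left L2_inner_scaleR_right) (simp add: algebra_simps)
    finally show ?thesis
      using h by (simp add: field_simps)
  qed
  have "((\<lambda>h. L2_inner M F' (G t) + L2_inner M (R h) (G t) + (L2_inner M (F t) G' + L2_inner M (F t) (Q h))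
      + h * (L2_inner M F' G' + L2_inner M F' (Q h) + (L2_inner M (R h) G' + L2_inner M (R h) (Q h))))
      \<longlongrightarrow> L2_inner M F' (G t) + 0 + (L2_inner M (F t) G' + 0)
        + 0 * (L2_inner M F' G' + 0 + (0 + 0))) (at 0)"
    by (intro tendsto_intros lim_R lim_Q lim_RQ f g)
  moreover have "\<forall>\<^sub>F h in at 0.
      L2_inner M F' (G t) + L2_inner M (R h) (G t) + (L2_inner M (F t) G' + L2_inner M (F t) (Q h))
      + h * (L2_inner M F' G' + L2_inner M F' (Q h) + (L2_inner M (R h) G' + L2_inner M (R h) (Q h)))
      = (L2_inner M (F (t + h)) (G (t + h)) - L2_inner M (F t) (G t)) / h"
    using R Q eventually_neq_at_within[of 0 0 UNIV] by eventually_elim (simp add: expand)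
  ultimately have "((\<lambda>h. (L2_inner M (F (t + h)) (G (t + h)) - L2_inner M (F t) (G t)) / h)
      \<longlongrightarrow> L2_inner M F' (G t) + L2_inner M (F t) G') (at 0)"
    by (auto dest: Lim_transform_eventually)
  then show ?thesis
    by (simp add: DERIV_def)
qed

text \<open>The product rule with a constant second factor; this form differentiates a weak equation
  whose test function is frozen.\<close>

lemma has_real_derivative_L2_inner_const:
  assumes "has_L2_deriv M F F' t" "L2 M g"
  shows "((\<lambda>s. L2_inner M (F s) g) has_real_derivative L2_inner M F' g) (at t)"
  using has_real_derivative_L2_inner[OF assms(1) has_L2_deriv_const[OF assms(2)]]
  by (simp add: L2_inner_def)

section \<open>Scalar permeabilities\<close>

lemma mat_vector_mult: "(mat c :: real^'d^'d) *v v = c *\<^sub>R v"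
  by (simp add: vec_eq_iff matrix_vector_mult_def mat_def if_distrib[of "\<lambda>a. a * _"] cong: if_cong)

lemma mat_mult_mat: "mat a ** mat b = (mat (a * b) :: real^'d^'d)"
  by (simp add: matrix_eq matrix_vector_mul_assoc[symmetric] mat_vector_mult)

text \<open>
  If \<open>B\<^sup>2 = c I\<close> and \<open>u = (B - \<surd>c) v\<close>, then \<open>B u = - \<surd>c u\<close>, which a positive semidefinite \<open>B\<close>
  only allows for \<open>u = 0\<close>.
\<close>

lemma mat_sqrt_mat:
  assumes c: "0 < c"
  shows "mat_sqrt (mat c :: real^'d^'d) = mat (sqrt c)"
  unfolding mat_sqrt_def
proof (rule the_equality)
  show "transpose (mat (sqrt c)) = (mat (sqrt c) :: real^'d^'d) \<and>
      (\<forall>v::real^'d. 0 \<le> v \<bullet> (mat (sqrt c) *v v)) \<and> mat (sqrt c) ** mat (sqrt c) = (mat c :: real^'d^'d)"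
    using c by (simp add: mat_vector_mult mat_mult_mat transpose_mat)
next
  fix B :: "real^'d^'d"
  assume B: "transpose B = B \<and> (\<forall>v. 0 \<le> v \<bullet> (B *v v)) \<and> B ** B = mat c"
  have "B *v v = sqrt c *\<^sub>R v" for v
  proof -
    define u where "u = B *v v - sqrt c *\<^sub>R v"
    have "B *v (B *v v) = c *\<^sub>R v"
      using B by (simp add: matrix_vector_mul_assoc mat_vector_mult)
    \<comment> \<open>Here \<open>B u = c v - \<surd>c B v\<close>, and \<open>- \<surd>c\<close>
      factors out.\<close>
    then have "B *v u = - sqrt c *\<^sub>R u"
      using c by (simp add: u_def matrix_vector_mult_diff_distrib matrix_vector_mult_scaleR
          scaleR_diff_right)
    then have "0 \<le> - (sqrt c * (u \<bullet> u))"
      using B by (metis inner_minus_right inner_scaleR_right scaleR_minus_left)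
    then have "u = 0"
      using c inner_gt_zero_iff[of u] by (simp add: mult_le_0_iff del: inner_gt_zero_iff)
    then show ?thesis by (simp add: u_def)
  qed
  then show "B = mat (sqrt c)"
    by (simp add: matrix_eq mat_vector_mult)
qed

text \<open>The mobility is the scalar matrix of \<open>k / \<eta>\<close> at \<open>x\<close> and
  its root that of the square root, so both forms give the same multiple of
  \<open>v \<bullet> v\<close>. This turns dissipation terms into squared norms.\<close>

lemma mobility_quadratic_form:
  assumes "K x = mat k" "0 < k" "0 < \<eta>"
  shows "(mobility \<eta> K x *v v) \<bullet> v = k / \<eta> * (v \<bullet> v)"
    and "(mat_sqrt (mobility \<eta> K x) *v v) \<bullet> (mat_sqrt (mobility \<eta> K x) *v v) = k / \<eta> * (v \<bullet> v)"
proof -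
  have "mobility \<eta> K x = mat (k / \<eta>)"
    using assms(1) by (simp add: mobility_def mat_def vec_eq_iff)
  then show "(mobility \<eta> K x *v v) \<bullet> v = k / \<eta> * (v \<bullet> v)"
    "(mat_sqrt (mobility \<eta> K x) *v v) \<bullet> (mat_sqrt (mobility \<eta> K x) *v v) = k / \<eta> * (v \<bullet> v)"
    using assms(2,3) by (simp_all add: mat_sqrt_mat mat_vector_mult mult.assoc[symmetric])
qed

section \<open>The surface measure and the normal field\<close>

text \<open>
  No measurability is assumed: on a complete measure it passes between functions that agree almost
  everywhere, and nonmeasurable functions have the junk integral 0. The fracture permeability is
  arbitrary off the fracture, a null set.
\<close>

lemma integral_cong_AE_completion:
  fixes f g :: "'a \<Rightarrow> 'b::euclidean_space"
  assumes ae: "AE x in completion M. f x = g x"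
  shows "integral\<^sup>L (completion M) f = integral\<^sup>L (completion M) g"
proof -
  have meas: "v \<in> borel_measurable (completion M)"
    if u: "u \<in> borel_measurable (completion M)" and eq: "AE x in completion M. u x = v x"
    for u v :: "'a \<Rightarrow> 'b"
  proof (rule measurableI)
    fix A :: "'b set" assume A: "A \<in> sets borel"
    show "v -` A \<inter> space (completion M) \<in> sets (completion M)"
    proof (rule completion.in_sets_AE)
      show "u -` A \<inter> space (completion M) \<in> sets (completion M)"
        using u A by (rule measurable_sets)
      show "AE x in completion M. x \<in> u -` A \<inter> space (completion M) \<longleftrightarrow> x \<in> v -` A \<inter> space (completion M)"
        using eq by eventually_elim simp
    qed simp
  qed simp
  have ae': "AE x in completion M. g x = f x"
    using ae by eventually_elim simp
  show ?thesis
  proof (cases "f \<in> borel_measurable (completion M)")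
    case True
    with meas[OF True ae] ae show ?thesis by (intro integral_cong_AE)
  next
    case False
    with meas[OF _ ae'] have "g \<notin> borel_measurable (completion M)" by blast
    with False have "\<not> integrable (completion M) f" "\<not> integrable (completion M) g"
      using borel_measurable_integrable by blast+
    then show ?thesis by (simp add: not_integrable_integral_eq)
  qed
qed

text \<open>Comparing products rather than factors allows a matrix root to be moved from one factor
  to the other.\<close>

lemma L2_inner_cong_AE_surface:
  assumes "AE x in surface_measure Fs. u x \<bullet> v x = u' x \<bullet> v' x"
  shows "L2_inner (surface_measure Fs) u v = L2_inner (surface_measure Fs) u' v'"
  using assms unfolding L2_inner_def surface_measure_def by (rule integral_cong_AE_completion)

lemma space_surface_measure: "space (surface_measure Fs) = UNIV"
  by (simp add: surface_measure_def)

lemma borel_sets_surface_measure: "A \<in> sets borel \<Longrightarrow> A \<in> sets (surface_measure Fs)"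
  using sets.sets_measure_of_eq[of borel] by (simp add: surface_measure_def sets_completionI_sets)

lemma borel_measurable_surface_measure:
  "f \<in> borel_measurable borel \<Longrightarrow> f \<in> borel_measurable (surface_measure Fs)"
  using borel_sets_surface_measure
  by (auto simp: measurable_def space_surface_measure)

lemma polygonal_surface_closed: "polygonal_surface Fs \<Longrightarrow> F \<in> Fs \<Longrightarrow> closed F"
  by (auto simp: polygonal_surface_def intro: polytope_imp_closed)

text \<open>The prism over the complement of the surface is empty for every facet, so this Borel set
  is null.\<close>

lemma AE_surface_measure_mem:
  fixes Fs :: "(real^'d) set set"
  assumes Fs: "polygonal_surface Fs"
  shows "AE x in surface_measure Fs. x \<in> \<Union>Fs"
proof (rule AE_I')
  have "closed (\<Union>Fs)"
    using Fs polygonal_surface_closed[OF Fs] by (auto simp: polygonal_surface_def)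
  then have *: "- \<Union>Fs \<in> sets borel" by (intro borel_comp borel_closed)
  have "prism F (- \<Union>Fs) = {}" if "F \<in> Fs" for F
    using that by (auto simp: prism_def)
  then have "emeasure (surface_measure Fs) (- \<Union>Fs) = 0"
    by (simp add: emeasure_surface_measure[OF Fs *])
  then show "- \<Union>Fs \<in> null_sets (surface_measure Fs)"
    using borel_sets_surface_measure[OF *] by blast
qed auto

text \<open>The facet chosen at \<open>x\<close> depends only on the set of facets containing
  \<open>x\<close>. Hence the field takes finitely many values, each on a union of cells
  \<open>?A I\<close> that are differences of closed sets.\<close>

lemma normal_field_measurable:
  fixes Cs :: "(real^'d) set set"
  assumes Cs: "polygonal_surface Cs"
  shows "normal_field Cs \<nu> \<in> borel_measurable borel"
proof -
  let ?A = "\<lambda>I. {x. {F \<in> Cs. x \<in> F} = I}"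
  have fin: "finite Cs" using Cs by (simp add: polygonal_surface_def)
  \<comment> \<open>Exactly one summand has indicator 1. For empty \<open>I\<close> it carries the
    same arbitrary value that the choice yields off the surface.\<close>
  have "normal_field Cs \<nu> x = (\<Sum>I\<in>Pow Cs. indicator (?A I) x *\<^sub>R \<nu> (SOME F. F \<in> I))" for x
  proof -
    have "(\<Sum>I\<in>Pow Cs. indicator (?A I) x *\<^sub>R \<nu> (SOME F. F \<in> I)) =
        (\<Sum>I\<in>Pow Cs. if I = {F \<in> Cs. x \<in> F} then \<nu> (SOME F. F \<in> I) else 0)"
      by (rule sum.cong) auto
    also have "\<dots> = \<nu> (SOME F. F \<in> {F \<in> Cs. x \<in> F})"
      using fin by (subst sum.delta) auto
    finally show ?thesis by (simp add: normal_field_def)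
  qed
  moreover have "?A I \<in> sets borel" if "I \<in> Pow Cs" for I
  proof -
    \<comment> \<open>For empty \<open>I\<close> the intersection is the whole space, and the cell
      is the complement of the surface.\<close>
    have "?A I = \<Inter>I - \<Union>(Cs - I)"
      using that by auto
    moreover have "closed (\<Inter>I)" "closed (\<Union>(Cs - I))"
      using that fin polygonal_surface_closed[OF Cs] by (auto intro!: closed_Inter closed_Union)
    ultimately show ?thesis by auto
  qed
  ultimately show ?thesis
    by (simp add: borel_measurable_sum borel_measurable_scaleR borel_measurable_indicator cong: measurable_cong)
qed

text \<open>Where some facet contains \<open>x\<close>, the choice picks one of them; elsewhere the
  value is arbitrary, but only on a null set.\<close>

lemma AE_norm_normal_field:
  assumes "fracture \<Omega> Cs \<nu>"
  shows "AE x in surface_measure Cs. norm (normal_field Cs \<nu> x) = 1"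
proof -
  have "polygonal_surface Cs" using assms by (simp add: fracture_def)
  from AE_surface_measure_mem[OF this] show ?thesis
  proof eventually_elim
    case (elim x)
    then have "\<exists>F. F \<in> Cs \<and> x \<in> F" by blast
    from someI_ex[OF this] show ?case
      using assms by (auto simp: normal_field_def fracture_def unit_normal_def)
  qed
qed

text \<open>Multiplying by a field of unit length almost everywhere preserves the norm. The product
  is the vector field against which traces are paired.\<close>

lemma L2_scaleR_normal_field:
  assumes frac: "fracture \<Omega> Cs \<nu>" and q: "L2 (surface_measure Cs) q"
  shows "L2 (surface_measure Cs) (\<lambda>x. q x *\<^sub>R normal_field Cs \<nu> x)"
proof (rule L2I)
  let ?S = "surface_measure Cs"
  have "normal_field Cs \<nu> \<in> borel_measurable ?S"
    using frac by (intro borel_measurable_surface_measure normal_field_measurable) (simp add: fracture_def)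
  with L2_measurable[OF q] show meas: "(\<lambda>x. q x *\<^sub>R normal_field Cs \<nu> x) \<in> borel_measurable ?S"
    by (rule borel_measurable_scaleR)
  show "integrable ?S (\<lambda>x. (q x *\<^sub>R normal_field Cs \<nu> x) \<bullet> (q x *\<^sub>R normal_field Cs \<nu> x))"
  proof (rule integrable_cong_AE_imp)
    show "integrable ?S (\<lambda>x. q x \<bullet> q x)" using q q by (rule L2_inner_integrable)
    show "(\<lambda>x. (q x *\<^sub>R normal_field Cs \<nu> x) \<bullet> (q x *\<^sub>R normal_field Cs \<nu> x)) \<in> borel_measurable ?S"
      using meas meas by (rule borel_measurable_inner)
    show "AE x in ?S. q x \<bullet> q x = (q x *\<^sub>R normal_field Cs \<nu> x) \<bullet> (q x *\<^sub>R normal_field Cs \<nu> x)"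
      using AE_norm_normal_field[OF frac] by eventually_elim (simp add: dot_square_norm power2_eq_square)
  qed
qed

text \<open>Moving the normal onto \<open>q\<close> expresses the pairing through the two vector
  traces, whose time derivatives are part of \<open>has_H1_deriv\<close>.\<close>

lemma L2_inner_normal_jump:
  assumes "L2 S (trace_plus U n v)" "L2 S (trace_minus U n v)" "L2 S (\<lambda>x. q x *\<^sub>R n x)"
  shows "L2_inner S (normal_jump U n v) q =
    L2_inner S (trace_plus U n v) (\<lambda>x. q x *\<^sub>R n x) - L2_inner S (trace_minus U n v) (\<lambda>x. q x *\<^sub>R n x)"
proof -
  have "L2_inner S (normal_jump U n v) q =
      L2_inner S (\<lambda>x. trace_plus U n v x - trace_minus U n v x) (\<lambda>x. q x *\<^sub>R n x)"
    by (simp add: L2_inner_def normal_jump_def jump_def mult.commute)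
  then show ?thesis
    using assms by (simp add: L2_inner_diff_left)
qed

section \<open>The energy law\<close>

text \<open>The strain is a fixed linear image of the Jacobian. Differentiating the Jacobian itself
  avoids asking whether the representatives chosen by \<open>wgrad\<close> depend linearly on the
  field.\<close>

lemma has_L2_deriv_strain:
  assumes "has_L2_deriv M (\<lambda>s. wjac U (w s)) (wjac U w') t"
  shows "has_L2_deriv M (\<lambda>s. strain U (w s)) (strain U w') t"
proof -
  have "linear (\<lambda>A::real^'d^'d. (1/2) *\<^sub>R (A + transpose A))"
    by (rule linearI) (simp_all add: vec_eq_iff transpose_def algebra_simps)
  then have "bounded_linear (\<lambda>A::real^'d^'d. (1/2) *\<^sub>R (A + transpose A))"
    by (rule linear_conv_bounded_linear[THEN iffD1])
  from has_L2_deriv_bounded_linear[OF this assms] show ?thesis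
    by (simp add: strain_def[abs_def])
qed

lemma has_L2_deriv_wdiv:
  assumes "has_L2_deriv M (\<lambda>s. wjac U (w s)) (wjac U w') t"
  shows "has_L2_deriv M (\<lambda>s. wdiv U (w s)) (wdiv U w') t"
proof -
  have "linear (\<lambda>A::real^'d^'d. \<Sum>i\<in>UNIV. A $ i $ i)"
    by (rule linearI) (simp_all add: sum.distrib sum_distrib_left)
  then have "bounded_linear (\<lambda>A::real^'d^'d. \<Sum>i\<in>UNIV. A $ i $ i)"
    by (rule linear_conv_bounded_linear[THEN iffD1])
  from has_L2_deriv_bounded_linear[OF this assms] show ?thesis
    by (simp add: wdiv_def[abs_def])
qed

section \<open>The energy and its time derivative\<close>

text \<open>Rewrites the energy in inner products, ready for the product rule. Square integrability
  of \<open>p\<close> and \<open>\<xi>\<close> lets the integral of the mixed square be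
  split.\<close>

lemma total_energy_eq:
  assumes "L2 (lebesgue_on U) p" "L2 (lebesgue_on U) \<xi>"
  shows "total_energy U S lam G \<alpha> c\<^sub>0 c\<^sub>f w p \<xi> p\<^sub>c =
     G * L2_inner (lebesgue_on U) (strain U w) (strain U w) +
     (\<alpha>\<^sup>2 * L2_inner (lebesgue_on U) p p - 2 * \<alpha> * L2_inner (lebesgue_on U) p \<xi>
       + L2_inner (lebesgue_on U) \<xi> \<xi>) / (2 * lam) +
     c\<^sub>0 / 2 * L2_inner (lebesgue_on U) p p + c\<^sub>f / 2 * L2_inner S p\<^sub>c p\<^sub>c"
proof -
  note i = L2_inner_integrable[OF assms(1,1)] L2_inner_integrable[OF assms] L2_inner_integrable[OF assms(2,2)]
  have "(\<lambda>x. (\<alpha> * p x - \<xi> x)\<^sup>2) = (\<lambda>x. \<alpha>\<^sup>2 * (p x \<bullet> p x) - 2 * \<alpha> * (p x \<bullet> \<xi> x) + \<xi> x \<bullet> \<xi> x)"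
    by (simp add: power2_eq_square algebra_simps fun_eq_iff)
  then have "(LINT x|lebesgue_on U. (\<alpha> * p x - \<xi> x)\<^sup>2) =
      \<alpha>\<^sup>2 * L2_inner (lebesgue_on U) p p - 2 * \<alpha> * L2_inner (lebesgue_on U) p \<xi>
       + L2_inner (lebesgue_on U) \<xi> \<xi>"
    using i by (simp add: L2_inner_def del: inner_real_def)
  then show ?thesis
    unfolding total_energy_def by (simp add: L2_inner_def power2_eq_square)
qed

lemma has_real_derivative_total_energy:
  assumes w: "has_L2_deriv (lebesgue_on U) (\<lambda>s. wjac U (w s)) (wjac U w') t"
    and p: "has_L2_deriv (lebesgue_on U) p p' t" and \<xi>: "has_L2_deriv (lebesgue_on U) \<xi> \<xi>' t"
    and p\<^sub>c: "has_L2_deriv S p\<^sub>c p\<^sub>c' t"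
  shows "((\<lambda>s. total_energy U S lam G \<alpha> c\<^sub>0 c\<^sub>f (w s) (p s) (\<xi> s) (p\<^sub>c s)) has_real_derivative
      2 * G * L2_inner (lebesgue_on U) (strain U (w t)) (strain U w') +
      (\<alpha>\<^sup>2 * L2_inner (lebesgue_on U) p' (p t) - \<alpha> * L2_inner (lebesgue_on U) p' (\<xi> t)
        - \<alpha> * L2_inner (lebesgue_on U) \<xi>' (p t) + L2_inner (lebesgue_on U) \<xi>' (\<xi> t)) / lam +
      c\<^sub>0 * L2_inner (lebesgue_on U) p' (p t) + c\<^sub>f * L2_inner S p\<^sub>c' (p\<^sub>c t)) (at t)"
    (is "(?E has_real_derivative ?E') (at t)")
proof -
  let ?M = "lebesgue_on U"
  note strain = has_L2_deriv_strain[OF w]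
  have "((\<lambda>s. G * L2_inner ?M (strain U (w s)) (strain U (w s)) +
     (\<alpha>\<^sup>2 * L2_inner ?M (p s) (p s) - 2 * \<alpha> * L2_inner ?M (p s) (\<xi> s) + L2_inner ?M (\<xi> s) (\<xi> s)) / (2 * lam) +
     c\<^sub>0 / 2 * L2_inner ?M (p s) (p s) + c\<^sub>f / 2 * L2_inner S (p\<^sub>c s) (p\<^sub>c s)) has_real_derivative
     G * (L2_inner ?M (strain U w') (strain U (w t)) + L2_inner ?M (strain U (w t)) (strain U w')) +
     (\<alpha>\<^sup>2 * (L2_inner ?M p' (p t) + L2_inner ?M (p t) p')
       - 2 * \<alpha> * (L2_inner ?M p' (\<xi> t) + L2_inner ?M (p t) \<xi>')
       + (L2_inner ?M \<xi>' (\<xi> t) + L2_inner ?M (\<xi> t) \<xi>')) / (2 * lam) +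
     c\<^sub>0 / 2 * (L2_inner ?M p' (p t) + L2_inner ?M (p t) p')
     + c\<^sub>f / 2 * (L2_inner S p\<^sub>c' (p\<^sub>c t) + L2_inner S (p\<^sub>c t) p\<^sub>c')) (at t)"
    (is "(?F has_real_derivative ?F') (at t)")
    by (intro DERIV_add DERIV_diff DERIV_cmult DERIV_cdivide has_real_derivative_L2_inner strain p \<xi> p\<^sub>c)
  \<comment> \<open>Symmetry merges the two halves of each product rule. For \<open>lam = 0\<close>
    both quotients are 0 by the convention for division.\<close>
  moreover have "?F' = ?E'"
    unfolding L2_inner_commute[of _ "strain U (w t)"] L2_inner_commute[of _ "p t"]
      L2_inner_commute[of _ "\<xi> t"] L2_inner_commute[of _ "p\<^sub>c t"]
    by (cases "lam = 0") (simp_all add: field_simps)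
  \<comment> \<open>The rewritten energy is available where \<open>p s\<close> and
    \<open>\<xi> s\<close> are square integrable, that is, for \<open>s\<close> near
    \<open>t\<close>; the derivative sees no more.\<close>
  moreover have "\<forall>\<^sub>F s in nhds t. ?E s = ?F s"
    using has_L2_derivD(1)[OF p] has_L2_derivD(1)[OF \<xi>] by eventually_elim (rule total_energy_eq)
  ultimately show ?thesis
    by (simp add: DERIV_cong_ev)
qed

section \<open>Dissipation terms as squared norms\<close>

lemma L2_norm_mat_sqrt_mobility:
  assumes K: "scalar_permeability (lebesgue_on U) U K" and \<eta>: "0 < \<eta>"
  shows "(L2_norm (lebesgue_on U) (\<lambda>x. mat_sqrt (mobility \<eta> K x) *v v x))\<^sup>2 =
    L2_inner (lebesgue_on U) (\<lambda>x. mobility \<eta> K x *v v x) v"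
  unfolding L2_norm_power2 L2_inner_def
proof (rule Bochner_Integration.integral_cong)
  obtain k where k: "\<And>x. x \<in> U \<Longrightarrow> 0 < k x \<and> K x = mat (k x)"
    using K by (auto simp: scalar_permeability_def)
  show "(mat_sqrt (mobility \<eta> K x) *v v x) \<bullet> (mat_sqrt (mobility \<eta> K x) *v v x) =
      (mobility \<eta> K x *v v x) \<bullet> v x" if "x \<in> space (lebesgue_on U)" for x
    using k[of x] that \<eta> by (simp add: mobility_quadratic_form)
qed simp

text \<open>The measure has the whole space as carrier while \<open>K\<close> is a scalar matrix on
  the facets, so the integrands are compared almost everywhere.\<close>

lemma L2_norm_mat_sqrt_mobility_surface:
  assumes Cs: "polygonal_surface Cs" and K: "scalar_permeability S (\<Union>Cs) K" and \<eta>: "0 < \<eta>"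
  shows "(L2_norm (surface_measure Cs) (\<lambda>x. mat_sqrt (mobility \<eta> K x) *v v x))\<^sup>2 =
    L2_inner (surface_measure Cs) (\<lambda>x. mobility \<eta> K x *v v x) v"
  unfolding L2_norm_power2
proof (rule L2_inner_cong_AE_surface)
  obtain k where k: "\<And>x. x \<in> \<Union>Cs \<Longrightarrow> 0 < k x \<and> K x = mat (k x)"
    using K by (auto simp: scalar_permeability_def)
  show "AE x in surface_measure Cs.
      (mat_sqrt (mobility \<eta> K x) *v v x) \<bullet> (mat_sqrt (mobility \<eta> K x) *v v x) =
      (mobility \<eta> K x *v v x) \<bullet> v x"
    using AE_surface_measure_mem[OF Cs]
  proof eventually_elim
    case (elim x)
    show ?case using k[OF elim] \<eta> by (simp add: mobility_quadratic_form)
  qed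
qed

lemma L2_inner_eq_zero_AE:
  assumes "AE x in M. f x = 0"
  shows "L2_inner M f g = 0"
  unfolding L2_inner_def using assms by (intro integral_eq_zero_AE) (auto elim: eventually_mono)

theorem theorem1:
  fixes \<Omega> U :: "(real^'d) set" and Bs Cs :: "(real^'d) set set"
    and \<nu> :: "(real^'d) set \<Rightarrow> real^'d" and n :: "real^'d \<Rightarrow> real^'d"
    and S :: "(real^'d) measure"
    and lam G \<alpha> c\<^sub>0 c\<^sub>f \<eta> T :: real
    and K K\<^sub>f :: "real^'d \<Rightarrow> real^'d^'d"
    and w w' f :: "real \<Rightarrow> real^'d \<Rightarrow> real^'d"
    and p p' \<xi> \<xi>' p\<^sub>c p\<^sub>c' w\<^sub>f' g\<^sub>s g\<^sub>f :: "real \<Rightarrow> real^'d \<Rightarrow> real"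
    and E :: "real \<Rightarrow> real"
  assumes dim: "CARD('d) = 2 \<or> CARD('d) = 3"
    and domain: "polyhedral_domain \<Omega> Bs"
    and interface: "fracture \<Omega> Cs \<nu>"
    and U: "U = \<Omega> - \<Union>Cs"
    and S: "S = surface_measure Cs"
    and n: "n = normal_field Cs \<nu>"
    and params: "lam > 0" "G > 0" "\<alpha> > 0" "c\<^sub>0 \<ge> 0" "c\<^sub>f > 0" "\<eta> > 0"
    and K: "scalar_permeability (lebesgue_on U) U K"
    and K\<^sub>f: "scalar_permeability S (\<Union>Cs) K\<^sub>f"
    and data: "\<forall>t\<in>{0<..<T}. L2 (lebesgue_on U) (f t) \<and> L2 (lebesgue_on U) (g\<^sub>s t) \<and> L2 S (g\<^sub>f t)"
    \<comment> \<open>regularity in space, \<open>w = 0\<close> on the outer boundary, \<open>p\<^sub>c = p\<close> on the fracture\<close>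
    and w_space: "\<forall>t\<in>{0<..<T}. displacement_space U Bs (w t)"
    and p_space: "\<forall>t\<in>{0<..<T}. pressure_space \<Omega> S n (p t)"
    and pc_space: "\<forall>t\<in>{0<..<T}. H1_surf S n (p\<^sub>c t)"
    and pc_eq: "\<forall>t\<in>{0<..<T}. AE x in S. p\<^sub>c t x = trace_on \<Omega> (p t) x"
    and flux: "\<forall>t\<in>{0<..<T}. has_two_traces U S n (\<lambda>x. mobility \<eta> K x *v wgrad U (p t) x) \<and>
                 L2 S (normal_jump U n (\<lambda>x. mobility \<eta> K x *v wgrad U (p t) x))"
    and width_bounded: "\<forall>t\<in>{0<..<T}. \<exists>B. AE x in S. \<bar>fracture_width U n (w t) x\<bar> \<le> B"
    and width_tip: "\<forall>t\<in>{0<..<T}. \<forall>x\<in>surface_boundary Cs.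
                      mean_limit S (CARD('d) - 1) (fracture_width U n (w t)) x 0"
    and xi: "\<forall>t\<in>{0<..<T}. AE x in lebesgue_on U. \<xi> t x = \<alpha> * p t x - lam * wdiv U (w t) x"
    \<comment> \<open>regularity in time; primes denote time derivatives\<close>
    and w_dt: "\<forall>t\<in>{0<..<T}. displacement_space U Bs (w' t) \<and> has_H1_deriv U S n w (w' t) t"
    and p_dt: "\<forall>t\<in>{0<..<T}. has_L2_deriv (lebesgue_on U) p (p' t) t"
    and xi_dt: "\<forall>t\<in>{0<..<T}. has_L2_deriv (lebesgue_on U) \<xi> (\<xi>' t) t"
    and pc_dt: "\<forall>t\<in>{0<..<T}. has_L2_deriv S p\<^sub>c (p\<^sub>c' t) t"
    and wf_dt: "\<forall>t\<in>{0<..<T}. has_L2_deriv S (\<lambda>s. fracture_width U n (w s)) (w\<^sub>f' t) t"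
    \<comment> \<open>the weak equations; \<open>u \<cdot> n = 0\<close> on the outer boundary is the natural boundary condition
        of \<open>mass_matrix\<close>, where \<open>q\<close> is not restricted on the outer boundary\<close>
    and momentum: "\<forall>t\<in>{0<..<T}. \<forall>v. displacement_space U Bs v \<longrightarrow>
          2 * G * L2_inner (lebesgue_on U) (strain U (w t)) (strain U v)
        - L2_inner (lebesgue_on U) (\<xi> t) (wdiv U v)
        + L2_inner S (p\<^sub>c t) (normal_jump U n v)
        = L2_inner (lebesgue_on U) (f t) v"
    and total_pressure: "\<forall>t\<in>{0<..<T}. \<forall>\<theta>. L2 (lebesgue_on U) \<theta> \<longrightarrow>
          1 / lam * L2_inner (lebesgue_on U) (\<xi> t) \<theta>
        + L2_inner (lebesgue_on U) (wdiv U (w t)) \<theta>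
        - \<alpha> / lam * L2_inner (lebesgue_on U) (p t) \<theta> = 0"
    and mass_matrix: "\<forall>t\<in>{0<..<T}. \<forall>q. pressure_space \<Omega> S n q \<longrightarrow>
          (c\<^sub>0 + \<alpha>\<^sup>2 / lam) * L2_inner (lebesgue_on U) (p' t) q
        - \<alpha> / lam * L2_inner (lebesgue_on U) (\<xi>' t) q
        + L2_inner (lebesgue_on U) (\<lambda>x. mobility \<eta> K x *v wgrad U (p t) x) (wgrad U q)
        - L2_inner S (normal_jump U n (\<lambda>x. mobility \<eta> K x *v wgrad U (p t) x)) (trace_on \<Omega> q)
        = L2_inner (lebesgue_on U) (g\<^sub>s t) q"
    and mass_fracture: "\<forall>t\<in>{0<..<T}. \<forall>q\<^sub>c. H1_surf S n q\<^sub>c \<longrightarrow>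
          L2_inner S (w\<^sub>f' t) q\<^sub>c
        + c\<^sub>f * L2_inner S (p\<^sub>c' t) q\<^sub>c
        + L2_inner S (\<lambda>x. mobility \<eta> K\<^sub>f x *v sgrad S n (p\<^sub>c t) x) (sgrad S n q\<^sub>c)
        + L2_inner S (normal_jump U n (\<lambda>x. mobility \<eta> K x *v wgrad U (p t) x)) q\<^sub>c
        = L2_inner S (g\<^sub>f t) q\<^sub>c"
    and E: "E = (\<lambda>t. total_energy U S lam G \<alpha> c\<^sub>0 c\<^sub>f (w t) (p t) (\<xi> t) (p\<^sub>c t))"
  shows "(\<forall>t\<in>{0<..<T}. E differentiable (at t) \<and>
            deriv E t
            + L2_inner (lebesgue_on U) (\<lambda>x. mobility \<eta> K x *v wgrad U (p t) x) (wgrad U (p t))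
            + L2_inner S (\<lambda>x. mobility \<eta> K\<^sub>f x *v sgrad S n (p\<^sub>c t) x) (sgrad S n (p\<^sub>c t))
            = L2_inner (lebesgue_on U) (f t) (w' t)
            + L2_inner (lebesgue_on U) (g\<^sub>s t) (p t)
            + L2_inner S (g\<^sub>f t) (p\<^sub>c t)) \<and>
         ((\<forall>t\<in>{0<..<T}. (AE x in lebesgue_on U. f t x = 0) \<and>
              (AE x in lebesgue_on U. g\<^sub>s t x = 0) \<and> (AE x in S. g\<^sub>f t x = 0)) \<longrightarrow>
          (\<forall>t\<in>{0<..<T}.
            deriv E t =
              - (L2_norm (lebesgue_on U) (\<lambda>x. mat_sqrt (mobility \<eta> K x) *v wgrad U (p t) x))\<^sup>2
              - (L2_norm S (\<lambda>x. mat_sqrt (mobility \<eta> K\<^sub>f x) *v sgrad S n (p\<^sub>c t) x))\<^sup>2 \<and>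
            deriv E t \<le> 0))"
proof -
  let ?M = "lebesgue_on U"
  define D where "D t = L2_inner ?M (\<lambda>x. mobility \<eta> K x *v wgrad U (p t) x) (wgrad U (p t))" for t
  define D\<^sub>f where "D\<^sub>f t = L2_inner S (\<lambda>x. mobility \<eta> K\<^sub>f x *v sgrad S n (p\<^sub>c t) x) (sgrad S n (p\<^sub>c t))" for t

  \<comment> \<open>The energy balance at a fixed time\<close>
  have law: "E differentiable (at t) \<and> deriv E t + D t + D\<^sub>f t =
      L2_inner ?M (f t) (w' t) + L2_inner ?M (g\<^sub>s t) (p t) + L2_inner S (g\<^sub>f t) (p\<^sub>c t)"
    if t: "t \<in> {0<..<T}" for t
  proof -
    have w: "has_H1_deriv U S n w (w' t) t" and w'_space: "displacement_space U Bs (w' t)"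
      and p: "has_L2_deriv ?M p (p' t) t" and \<xi>: "has_L2_deriv ?M \<xi> (\<xi>' t) t"
      and p\<^sub>c: "has_L2_deriv S p\<^sub>c (p\<^sub>c' t) t"
      and w\<^sub>f: "has_L2_deriv S (\<lambda>s. fracture_width U n (w s)) (w\<^sub>f' t) t"
      using w_dt p_dt xi_dt pc_dt wf_dt t by blast+
    have jac: "has_L2_deriv ?M (\<lambda>s. wjac U (w s)) (wjac U (w' t)) t"
      and plus: "has_L2_deriv S (\<lambda>s. trace_plus U n (w s)) (trace_plus U n (w' t)) t"
      and minus: "has_L2_deriv S (\<lambda>s. trace_minus U n (w s)) (trace_minus U n (w' t)) t"
      using w by (simp_all add: has_H1_deriv_def)
    note L2_\<xi> = has_L2_derivD(3)[OF \<xi>] and L2_pc = has_L2_derivD(3)[OF p\<^sub>c]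
    have E': "(E has_real_derivative
      2 * G * L2_inner ?M (strain U (w t)) (strain U (w' t)) +
      (\<alpha>\<^sup>2 * L2_inner ?M (p' t) (p t) - \<alpha> * L2_inner ?M (p' t) (\<xi> t)
        - \<alpha> * L2_inner ?M (\<xi>' t) (p t) + L2_inner ?M (\<xi>' t) (\<xi> t)) / lam +
      c\<^sub>0 * L2_inner ?M (p' t) (p t) + c\<^sub>f * L2_inner S (p\<^sub>c' t) (p\<^sub>c t)) (at t)"
      unfolding E by (rule has_real_derivative_total_energy[OF jac p \<xi> p\<^sub>c])

    \<comment> \<open>The time interval is open, so identities valid on it hold near
      \<open>t\<close> and can be differentiated there.\<close>
    have near_t: "\<forall>\<^sub>F s in nhds t. s \<in> {0<..<T}"
      using t by (intro eventually_nhds_in_open) auto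
    have mechanics: "2 * G * L2_inner ?M (strain U (w t)) (strain U (w' t))
        - L2_inner ?M (\<xi> t) (wdiv U (w' t)) + L2_inner S (p\<^sub>c t) (normal_jump U n (w' t))
        = L2_inner ?M (f t) (w' t)"
      using momentum t w'_space by blast
    \<comment> \<open>The test function is frozen at \<open>\<xi> t\<close> while \<open>s\<close>
      varies; the left side then vanishes for all \<open>s\<close> near \<open>t\<close>, and so
      does its derivative.\<close>
    have pressure': "1 / lam * L2_inner ?M (\<xi>' t) (\<xi> t) + L2_inner ?M (wdiv U (w' t)) (\<xi> t)
        - \<alpha> / lam * L2_inner ?M (p' t) (\<xi> t) = 0"
    proof (rule DERIV_unique)
      show "((\<lambda>s. 1 / lam * L2_inner ?M (\<xi> s) (\<xi> t) + L2_inner ?M (wdiv U (w s)) (\<xi> t)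
          - \<alpha> / lam * L2_inner ?M (p s) (\<xi> t)) has_real_derivative
          1 / lam * L2_inner ?M (\<xi>' t) (\<xi> t) + L2_inner ?M (wdiv U (w' t)) (\<xi> t)
        - \<alpha> / lam * L2_inner ?M (p' t) (\<xi> t)) (at t)"
        by (intro DERIV_add DERIV_diff DERIV_cmult has_real_derivative_L2_inner_const
            has_L2_deriv_wdiv jac \<xi> p L2_\<xi>)
      have "\<forall>\<^sub>F s in nhds t. 1 / lam * L2_inner ?M (\<xi> s) (\<xi> t) + L2_inner ?M (wdiv U (w s)) (\<xi> t)
          - \<alpha> / lam * L2_inner ?M (p s) (\<xi> t) = 0"
        using near_t by eventually_elim (use total_pressure L2_\<xi> in blast)
      then show "((\<lambda>s. 1 / lam * L2_inner ?M (\<xi> s) (\<xi> t) + L2_inner ?M (wdiv U (w s)) (\<xi> t)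
          - \<alpha> / lam * L2_inner ?M (p s) (\<xi> t)) has_real_derivative 0) (at t)"
        by (simp add: DERIV_cong_ev[OF refl _ refl, where g = "\<lambda>_. 0"])
    qed
    have L2_normal: "L2 S (\<lambda>x. p\<^sub>c t x *\<^sub>R n x)"
      using L2_scaleR_normal_field[OF interface] L2_pc by (simp add: S n)
    \<comment> \<open>The same real function of \<open>s\<close> is differentiated twice: through
      the width, whose derivative is \<open>w\<^sub>f'\<close>, and through the traces of
      \<open>w\<close>, whose derivatives are those of \<open>w'\<close>.\<close>
    have width': "L2_inner S (w\<^sub>f' t) (p\<^sub>c t) = - L2_inner S (normal_jump U n (w' t)) (p\<^sub>c t)"
    proof (rule DERIV_unique)
      show "((\<lambda>s. L2_inner S (fracture_width U n (w s)) (p\<^sub>c t)) has_real_derivative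
          L2_inner S (w\<^sub>f' t) (p\<^sub>c t)) (at t)"
        by (rule has_real_derivative_L2_inner_const[OF w\<^sub>f L2_pc])
      have "((\<lambda>s. - (L2_inner S (trace_plus U n (w s)) (\<lambda>x. p\<^sub>c t x *\<^sub>R n x)
            - L2_inner S (trace_minus U n (w s)) (\<lambda>x. p\<^sub>c t x *\<^sub>R n x))) has_real_derivative
          - (L2_inner S (trace_plus U n (w' t)) (\<lambda>x. p\<^sub>c t x *\<^sub>R n x)
            - L2_inner S (trace_minus U n (w' t)) (\<lambda>x. p\<^sub>c t x *\<^sub>R n x))) (at t)"
        by (intro DERIV_minus DERIV_diff has_real_derivative_L2_inner_const plus minus L2_normal)
      moreover have "\<forall>\<^sub>F s in nhds t. L2_inner S (fracture_width U n (w s)) (p\<^sub>c t) =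
          - (L2_inner S (trace_plus U n (w s)) (\<lambda>x. p\<^sub>c t x *\<^sub>R n x)
            - L2_inner S (trace_minus U n (w s)) (\<lambda>x. p\<^sub>c t x *\<^sub>R n x))"
        using has_L2_derivD(1)[OF plus] has_L2_derivD(1)[OF minus]
      proof eventually_elim
        case (elim s)
        have "L2_inner S (fracture_width U n (w s)) (p\<^sub>c t) = - L2_inner S (normal_jump U n (w s)) (p\<^sub>c t)"
          by (simp add: L2_inner_def fracture_width_def[abs_def])
        then show ?case
          by (simp add: L2_inner_normal_jump[OF elim L2_normal])
      qed
      ultimately show "((\<lambda>s. L2_inner S (fracture_width U n (w s)) (p\<^sub>c t)) has_real_derivative
          - L2_inner S (normal_jump U n (w' t)) (p\<^sub>c t)) (at t)"
        unfolding L2_inner_normal_jump[OF has_L2_derivD(2)[OF plus] has_L2_derivD(2)[OF minus] L2_normal]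
        by (subst DERIV_cong_ev[OF refl _ refl])
    qed
    let ?j = "normal_jump U n (\<lambda>x. mobility \<eta> K x *v wgrad U (p t) x)"
    have "AE x in S. p\<^sub>c t x = trace_on \<Omega> (p t) x"
      using pc_eq t by blast
    \<comment> \<open>Replaces the trace of \<open>p\<close> by \<open>p\<^sub>c\<close>, so that
      the flux jump appears in \<open>matrix\<close> and \<open>fracture\<close> as the same number
      with opposite signs.\<close>
    then have jump_eq: "L2_inner S ?j (trace_on \<Omega> (p t)) = L2_inner S ?j (p\<^sub>c t)"
      unfolding S by (intro L2_inner_cong_AE_surface) (auto elim: eventually_mono)
    have matrix: "(c\<^sub>0 + \<alpha>\<^sup>2 / lam) * L2_inner ?M (p' t) (p t) - \<alpha> / lam * L2_inner ?M (\<xi>' t) (p t)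
        + D t - L2_inner S ?j (p\<^sub>c t) = L2_inner ?M (g\<^sub>s t) (p t)"
      using mass_matrix[rule_format, OF t, of "p t"] p_space t by (simp add: D_def jump_eq)
    have fracture: "L2_inner S (w\<^sub>f' t) (p\<^sub>c t) + c\<^sub>f * L2_inner S (p\<^sub>c' t) (p\<^sub>c t)
        + D\<^sub>f t + L2_inner S ?j (p\<^sub>c t) = L2_inner S (g\<^sub>f t) (p\<^sub>c t)"
      using mass_fracture[rule_format, OF t, of "p\<^sub>c t"] pc_space t by (simp add: D\<^sub>f_def)
    \<comment> \<open>Besides the interface terms, the pairings of \<open>\<xi> t\<close> with the
      divergence of \<open>w' t\<close> cancel: \<open>mechanics\<close> and
      \<open>pressure'\<close> contribute them with opposite signs. The remaining
      \<open>\<xi>'\<close> and \<open>p'\<close> terms assemble the derivative of the square of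
      \<open>\<alpha> p - \<xi>\<close>.\<close>
    have "deriv E t + D t + D\<^sub>f t =
        L2_inner ?M (f t) (w' t) + L2_inner ?M (g\<^sub>s t) (p t) + L2_inner S (g\<^sub>f t) (p\<^sub>c t)"
      unfolding DERIV_imp_deriv[OF E']
      using mechanics pressure' width' matrix fracture
        L2_inner_commute[of S "p\<^sub>c t"] L2_inner_commute[of ?M "\<xi> t" "wdiv U (w' t)"]
      by (simp add: diff_divide_distrib add_divide_distrib distrib_right)
    with E' show ?thesis
      by (auto simp: real_differentiable_def)
  qed

  \<comment> \<open>Decay of the energy without sources\<close>
  have D: "D t = (L2_norm ?M (\<lambda>x. mat_sqrt (mobility \<eta> K x) *v wgrad U (p t) x))\<^sup>2" for t
    unfolding D_def by (rule L2_norm_mat_sqrt_mobility[OF K params(6), symmetric])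
  have D\<^sub>f: "D\<^sub>f t = (L2_norm S (\<lambda>x. mat_sqrt (mobility \<eta> K\<^sub>f x) *v sgrad S n (p\<^sub>c t) x))\<^sup>2" for t
    unfolding D\<^sub>f_def S using interface K\<^sub>f params(6)
    by (intro L2_norm_mat_sqrt_mobility_surface[symmetric]) (auto simp: fracture_def)
  have dissipation: "deriv E t = - D t - D\<^sub>f t"
    if t: "t \<in> {0<..<T}" and "AE x in ?M. f t x = 0" "AE x in ?M. g\<^sub>s t x = 0" "AE x in S. g\<^sub>f t x = 0" for t
    using law[OF t] that(2-4) by (simp add: L2_inner_eq_zero_AE)
  have "- D t - D\<^sub>f t \<le> 0" for t
    unfolding D D\<^sub>f using zero_le_power2 by (simp add: add_nonneg_nonneg algebra_simps)
  with dissipation have decay: "deriv E t = - D t - D\<^sub>f t \<and> deriv E t \<le> 0"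
    if "t \<in> {0<..<T}" "AE x in ?M. f t x = 0" "AE x in ?M. g\<^sub>s t x = 0" "AE x in S. g\<^sub>f t x = 0" for t
    using that by simp
  show ?thesis
    using law decay unfolding D[symmetric] D\<^sub>f[symmetric] D_def[symmetric] D\<^sub>f_def[symmetric] by blast
qed

end
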